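(* Let $D$ be a diagram of a link $L$ and let $D'$ be the diagram obtained from $D$ by performing a single Reidemeister move inside a small disk $\mathbb{D}^2$. If $g_T(D')<g_T(D)$, then the move is either an inverse Type II move (removing two crossings) or a Type III move. Moreover: (1) Suppose the move is an inverse Type II move. Label the four points of $D\cap\partial\mathbb{D}^2$ by $a,b,c,d$ so that in $D'$ the two strands inside $\mathbb{D}^2$ join $a$ to $c$ and $b$ to $d$, while in both the all-$A$ and the all-$B$ state of $D$ the arcs inside $\mathbb{D}^2$ join $a$ to $b$ and $c$ to $d$. Then in at least one of the all-$A$ state and the all-$B$ state of $D$, the arcs of the state outside $\mathbb{D}^2$ join $a$ to $c$ and $b$ to $d$. (2) Suppose the move is a Type III move. Let $X\in\{A,B\}$ be the resolution type for which the all-$X$ states of $D$ and $D'$ differ inside $\mathbb{D}^2$, and label the six points of $D\cap\partial\mathbb{D}^2$ by $a,b,c,d,e,f$ in cyclic order so that inside $\mathbb{D}^2$ the all-$X$ state of $D$ joins $a$ to $b$, $c$ to $d$, $e$ to $f$, and the all-$X$ state of $D'$ joins $a$ to $f$, $b$ to $c$, $d$ to $e$. Then the arcs of the all-$X$ state of $D$ outside $\mathbb{D}^2$ join $a$ to $f$, $b$ to $c$, and $d$ to $e$.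
   Context: The $A$- and $B$-resolutions of a crossing are the two smoothings in the Kauffman bracket relation: drawing the crossing with overstrand of slope $+1$ and understrand of slope $-1$, the $A$-resolution is $)($ and the $B$-resolution is $\asymp$. The all-$A$ (all-$B$) state of a diagram is the collection of disjoint circles obtained by choosing the $A$-resolution ($B$-resolution) at every crossing; $|\sigma_A(D)|$ and $|\sigma_B(D)|$ denote the numbers of circles. With $c(D)$ the number of crossings, the Turaev genus of a diagram is $g_T(D)=\frac{c(D)+2-|\sigma_A(D)|-|\sigma_B(D)|}{2}$. The disk $\mathbb{D}^2$ lies in the projection plane, its boundary meets $D$ transversely away from the crossings, $D$ and $D'$ agree outside $\mathbb{D}^2$, and inside $\mathbb{D}^2$ they are the two sides of a standard Reidemeister move (of Type I, II or III, in either direction). Local states at a Type III move: it relates two three-crossing tangles with six boundary points. For exactly one of the two resolution types the all-resolution states of the two tangles induce the same matching of the six boundary points; for the other type $X$ the two tangles induce two different matchings. There are no closed circles inside $\mathbb{D}^2$ in the all-$X$ states, and with boundary points labelled $a,b,c,d,e,f$ in cyclic order the two matchings are $\{ab,cd,ef\}$ and $\{af,bc,de\}$, so a labelling as in the claim exists. The two versions of the Type III move (the move and its mirror image) correspond to $X=B$ and $X=A$. *)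

theory Defs
  imports Complex_Main "HOL-Combinatorics.Combinatorics"
begin

text \<open>
  A link diagram on the sphere is encoded as a combinatorial map: a 4-valent plane graph,
  subdivided by finitely many 2-valent vertices, is given by its darts (half-edges), the involution
  \<open>edge\<close> exchanging the two halves of an edge, and the permutation \<open>rot\<close> sending a dart to the next
  dart in counterclockwise order around its vertex.  The 4-valent vertices are the crossings and
  \<open>over\<close> is the set of darts on the overstrands.  The 2-valent vertices are marked points on the
  strands: they carry crossingless components, and the points where the diagram meets the boundary of
  a disk.
\<close>

record 'd diagram =
  darts :: "'d set"
  edge :: "'d \<Rightarrow> 'd"
  rot :: "'d \<Rightarrow> 'd"
  over :: "'d set"

text \<open>
  Euler's formula $V - E + F = 2K$ for a map with $K$ connected components.  The faces are the
  orbits of \<open>r \<circ> e\<close>.  Since $V - E + F \le 2$ on each component, equality says that every component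
  has genus 0.
\<close>

definition planar_map :: "'d set \<Rightarrow> ('d \<Rightarrow> 'd) \<Rightarrow> ('d \<Rightarrow> 'd) \<Rightarrow> bool" where
  "planar_map H e r \<longleftrightarrow>
     card (orbit r ` H) + card (orbit (r \<circ> e) ` H)
       = card (orbit e ` H) + 2 * card (H // {(x, y). y = e x \<or> y = r x}\<^sup>*)"

definition crossing_darts :: "'d diagram \<Rightarrow> 'd set" where
  "crossing_darts D = {d \<in> darts D. card (orbit (rot D) d) = 4}"

definition link_diagram :: "'d diagram \<Rightarrow> bool" where
  "link_diagram D \<longleftrightarrow>
     finite (darts D) \<and>
     edge D permutes darts D \<and> (\<forall>d\<in>darts D. edge D d \<noteq> d \<and> edge D (edge D d) = d) \<and>
     rot D permutes darts D \<and> (\<forall>d\<in>darts D. card (orbit (rot D) d) \<in> {2, 4}) \<and>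
     over D \<subseteq> crossing_darts D \<and>
     (\<forall>d\<in>crossing_darts D. rot D d \<in> over D \<longleftrightarrow> d \<notin> over D) \<and>
     planar_map (darts D) (edge D) (rot D)"

definition crossing_number :: "'d diagram \<Rightarrow> nat" where
  "crossing_number D = card (orbit (rot D) ` crossing_darts D)"

datatype resolution = Res_A | Res_B

text \<open>
  If the overstrand has slope $+1$, the darts at a crossing are, counterclockwise, NE (over), NW
  (under), SW (over), SE (under).  The A-resolution joins NW with SW and NE with SE, that is, each
  under-dart with its counterclockwise successor; the B-resolution joins each over-dart with its
  counterclockwise successor.
\<close>

definition resolve :: "'d diagram \<Rightarrow> resolution \<Rightarrow> 'd \<Rightarrow> 'd" where
  "resolve D X d =
     (if d \<notin> crossing_darts D \<or> (d \<in> over D \<longleftrightarrow> X = Res_B) then rot D d else inv (rot D) d)"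

definition straight :: "'d diagram \<Rightarrow> 'd \<Rightarrow> 'd" where
  "straight D d = (if d \<in> crossing_darts D then rot D (rot D d) else rot D d)"

text \<open>
  Two darts in \<open>S\<close> are related if they are connected, without leaving \<open>S\<close>, by the curves that run
  along the edges of \<open>D\<close> and pass through the vertices as prescribed by \<open>t\<close>: the curves of the
  all-\<open>X\<close> state for \<open>t = resolve D X\<close>, the strands of the link for \<open>t = straight D\<close>.
\<close>

definition curves :: "'d diagram \<Rightarrow> ('d \<Rightarrow> 'd) \<Rightarrow> 'd set \<Rightarrow> ('d \<times> 'd) set" where
  "curves D t S = {(d, d'). d \<in> S \<and> d' \<in> S \<and> (d' = edge D d \<or> d' = t d)}\<^sup>*"

definition state_circles :: "'d diagram \<Rightarrow> resolution \<Rightarrow> nat" where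
  "state_circles D X = card (darts D // curves D (resolve D X) (darts D))"

definition turaev_genus :: "'d diagram \<Rightarrow> real" where
  "turaev_genus D =
     (real (crossing_number D) + 2 - real (state_circles D Res_A) - real (state_circles D Res_B)) / 2"

text \<open>
  A disk is described by the set \<open>I\<close> of darts inside it and the list \<open>bs\<close> of the points where its
  boundary meets \<open>D\<close>, in counterclockwise order along the boundary.  These points are 2-valent
  vertices with one dart inside and one outside, and are named by the dart inside.  Collapsing the
  exterior (or the interior) of the disk to a point turns the rest of \<open>D\<close> into a map on the sphere
  with one additional vertex at which the boundary points appear in this cyclic order; seen from the
  collapsed exterior the order is reversed.
\<close>

definition cap :: "'d list \<Rightarrow> ('d \<Rightarrow> 'd) \<Rightarrow> 'd \<Rightarrow> 'd" where
  "cap cs r d = (if d \<in> set cs then cycle_of_list cs d else r d)"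

definition disk :: "'d diagram \<Rightarrow> 'd set \<Rightarrow> 'd list \<Rightarrow> bool" where
  "disk D I bs \<longleftrightarrow>
     I \<subseteq> darts D \<and> edge D ` I = I \<and>
     distinct bs \<and> set bs = {d \<in> I. rot D d \<notin> I} \<and> set bs \<inter> crossing_darts D = {} \<and>
     planar_map I (edge D) (cap (rev bs) (rot D)) \<and>
     planar_map (darts D - I) (edge D) (cap (map (rot D) bs) (rot D))"

definition joins_inside :: "'d diagram \<Rightarrow> ('d \<Rightarrow> 'd) \<Rightarrow> 'd set \<Rightarrow> 'd \<Rightarrow> 'd \<Rightarrow> bool" where
  "joins_inside D t I p q \<longleftrightarrow> (p, q) \<in> curves D t I"

definition joins_outside :: "'d diagram \<Rightarrow> ('d \<Rightarrow> 'd) \<Rightarrow> 'd set \<Rightarrow> 'd \<Rightarrow> 'd \<Rightarrow> bool" where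
  "joins_outside D t I p q \<longleftrightarrow> (rot D p, rot D q) \<in> curves D t (darts D - I)"

definition inside_matching ::
    "'d diagram \<Rightarrow> ('d \<Rightarrow> 'd) \<Rightarrow> 'd set \<Rightarrow> 'd list \<Rightarrow> ('d \<times> 'd) set" where
  "inside_matching D t I bs =
     {(p, q). p \<in> set bs \<and> q \<in> set bs \<and> p \<noteq> q \<and> joins_inside D t I p q}"

definition agree_outside :: "'d diagram \<Rightarrow> 'd set \<Rightarrow> 'd diagram \<Rightarrow> 'd set \<Rightarrow> bool" where
  "agree_outside D I D' I' \<longleftrightarrow>
     darts D - I = darts D' - I' \<and> over D - I = over D' - I' \<and>
     (\<forall>d\<in>darts D - I. edge D d = edge D' d \<and> rot D d = rot D' d)"

text \<open>
  \<open>crossing_at D h xs\<close>: the list \<open>xs\<close> consists of the darts at a crossing in counterclockwise order,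
  and \<open>h\<close> tells whether the strand through the first and the third dart is the overstrand.
\<close>

definition crossing_at :: "'d diagram \<Rightarrow> bool \<Rightarrow> 'd list \<Rightarrow> bool" where
  "crossing_at D h xs \<longleftrightarrow>
     length xs = 4 \<and> distinct xs \<and> (\<forall>i<4. rot D (xs ! i) = xs ! ((i + 1) mod 4)) \<and>
     (xs ! 0 \<in> over D \<longleftrightarrow> h)"

definition arc_tangle :: "'d diagram \<Rightarrow> 'd set \<Rightarrow> 'd list \<Rightarrow> bool" where
  "arc_tangle D I bs \<longleftrightarrow> (\<exists>p q. bs = [p, q] \<and> I = {p, q} \<and> edge D p = q)"

definition kink_tangle :: "'d diagram \<Rightarrow> 'd set \<Rightarrow> 'd list \<Rightarrow> bool" where
  "kink_tangle D I bs \<longleftrightarrow>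
     (\<exists>p q x0 x1 x2 x3 h. bs = [p, q] \<and>
        I = set (bs @ [x0, x1, x2, x3]) \<and> distinct (bs @ [x0, x1, x2, x3]) \<and>
        crossing_at D h [x0, x1, x2, x3] \<and>
        edge D p = x0 \<and> edge D q = x1 \<and> edge D x2 = x3)"

text \<open>
  In the following two tangles the boundary points, listed counterclockwise, are NW, SW, SE, NE.
  The two strands run from NW to NE and from SW to SE; in the second tangle they cross twice, at a
  left crossing \<open>x\<close> and a right crossing \<open>y\<close> whose darts are listed in the order NE, NW, SW, SE,
  one strand (the one ending at SW and SE iff \<open>h\<close>) running over the other at both crossings.
\<close>

definition parallel_tangle :: "'d diagram \<Rightarrow> 'd set \<Rightarrow> 'd list \<Rightarrow> bool" where
  "parallel_tangle D I bs \<longleftrightarrow>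
     (\<exists>nw sw se ne. bs = [nw, sw, se, ne] \<and> I = set bs \<and> distinct bs \<and>
        edge D nw = ne \<and> edge D sw = se)"

definition bigon_tangle :: "'d diagram \<Rightarrow> 'd set \<Rightarrow> 'd list \<Rightarrow> bool" where
  "bigon_tangle D I bs \<longleftrightarrow>
     (\<exists>nw sw se ne x0 x1 x2 x3 y0 y1 y2 y3 h. bs = [nw, sw, se, ne] \<and>
        I = set (bs @ [x0, x1, x2, x3] @ [y0, y1, y2, y3]) \<and>
        distinct (bs @ [x0, x1, x2, x3] @ [y0, y1, y2, y3]) \<and>
        crossing_at D h [x0, x1, x2, x3] \<and> crossing_at D (\<not> h) [y0, y1, y2, y3] \<and>
        edge D nw = x1 \<and> edge D sw = x2 \<and> edge D se = y3 \<and> edge D ne = y0 \<and>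
        edge D x0 = y1 \<and> edge D x3 = y2)"

text \<open>
  Three strands with endpoints \<open>p0 p3\<close>, \<open>p1 p4\<close> and \<open>p2 p5\<close> at pairwise distinct heights \<open>h0\<close>,
  \<open>h1\<close> and \<open>h2\<close>, crossing each other near the boundary arcs \<open>p0 p1\<close> (crossing \<open>u\<close>), \<open>p2 p3\<close>
  (crossing \<open>w\<close>) and \<open>p4 p5\<close> (crossing \<open>v\<close>).  At each crossing the first two darts point towards
  the boundary, the last two are sides of the central triangle.  The same strands cross on the other
  side of the triangle precisely if they form this tangle with respect to \<open>p1 p2 p3 p4 p5 p0\<close>.
\<close>

definition triangle_tangle ::
    "'d diagram \<Rightarrow> 'd set \<Rightarrow> 'd list \<Rightarrow> nat \<Rightarrow> nat \<Rightarrow> nat \<Rightarrow> bool" where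
  "triangle_tangle D I bs h0 h1 h2 \<longleftrightarrow>
     distinct [h0, h1, h2] \<and>
     (\<exists>p0 p1 p2 p3 p4 p5 u0 u1 u2 u3 v0 v1 v2 v3 w0 w1 w2 w3. bs = [p0, p1, p2, p3, p4, p5] \<and>
        I = set (bs @ [u0, u1, u2, u3] @ [v0, v1, v2, v3] @ [w0, w1, w2, w3]) \<and>
        distinct (bs @ [u0, u1, u2, u3] @ [v0, v1, v2, v3] @ [w0, w1, w2, w3]) \<and>
        crossing_at D (h0 > h1) [u0, u1, u2, u3] \<and>
        crossing_at D (h2 > h0) [w0, w1, w2, w3] \<and>
        crossing_at D (h1 > h2) [v0, v1, v2, v3] \<and>
        edge D p0 = u0 \<and> edge D p1 = u1 \<and>
        edge D p2 = w0 \<and> edge D p3 = w1 \<and>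
        edge D p4 = v0 \<and> edge D p5 = v1 \<and>
        edge D u2 = w3 \<and> edge D w2 = v3 \<and> edge D v2 = u3)"

datatype move_type = R1_create | R1_remove | R2_create | R2_remove | R3

fun local_move ::
    "move_type \<Rightarrow> 'd diagram \<Rightarrow> 'd set \<Rightarrow> 'd diagram \<Rightarrow> 'd set \<Rightarrow> 'd list \<Rightarrow> bool" where
  "local_move R1_create D I D' I' bs \<longleftrightarrow> arc_tangle D I bs \<and> kink_tangle D' I' bs"
| "local_move R1_remove D I D' I' bs \<longleftrightarrow> kink_tangle D I bs \<and> arc_tangle D' I' bs"
| "local_move R2_create D I D' I' bs \<longleftrightarrow> parallel_tangle D I bs \<and> bigon_tangle D' I' bs"
| "local_move R2_remove D I D' I' bs \<longleftrightarrow> bigon_tangle D I bs \<and> parallel_tangle D' I' bs"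
| "local_move R3 D I D' I' bs \<longleftrightarrow>
     (\<exists>h0 h1 h2. triangle_tangle D I bs h0 h1 h2 \<and> triangle_tangle D' I' (rotate1 bs) h1 h2 h0)"

text \<open>
  The first boundary point in \<open>bs\<close> may be chosen freely, as \<open>disk\<close> depends only on the cyclic order.
\<close>

definition reidemeister_move ::
    "move_type \<Rightarrow> 'd diagram \<Rightarrow> 'd set \<Rightarrow> 'd diagram \<Rightarrow> 'd set \<Rightarrow> 'd list \<Rightarrow> bool" where
  "reidemeister_move m D I D' I' bs \<longleftrightarrow>
     link_diagram D \<and> link_diagram D' \<and> disk D I bs \<and> disk D' I' bs \<and>
     agree_outside D I D' I' \<and> local_move m D I D' I' bs"

text \<open>Both directions along the boundary circle count as cyclic order.\<close>

definition in_cyclic_order :: "'d list \<Rightarrow> 'd list \<Rightarrow> bool" where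
  "in_cyclic_order bs ps \<longleftrightarrow> (\<exists>k. ps = rotate k bs \<or> ps = rotate k (rev bs))"

end

theory Submission
  imports Defs
begin

text \<open>
  Outside the disk, the all-\<open>X\<close> state of \<open>D\<close> consists of circles and arcs that \<open>D'\<close> shares; inside,
  each diagram has an explicit matching of the boundary points and possibly a closed circle.
  Hence the number of state circles is found by joining classes of exterior curves along the
  pairs of the inner matching (\<open>state_circles_inside\<close>), and the effect of a given move on the
  Turaev genus depends only on how the exterior curves group the boundary points.

  A Type I move changes the number of crossings and the total number of circles in both states by
  the same amount.  For the other moves the essential restriction is that an exterior arc joins boundary points of opposite
  parity in the cyclic order.  In the smoothings both the vertex steps and the edge steps cross
  from one colour to the other in the checkerboard colouring of the darts, and the colour
  alternates along the boundary circle.  Therefore every exterior class contains as many even as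
  odd boundary points (\<open>balanced_classes\<close>).  The conclusions follow from this balance by counting: with four
  boundary points the classes contain one of two matchings, with six points one of six, and in each
  case the circles before and after the move can be counted (\<open>four_balanced_points\<close>,
  \<open>six_balanced_points\<close>).

  The checkerboard colouring of the planar exterior, with the disk collapsed to a vertex of even
  degree, is the content of \<open>checkerboard_colouring\<close>.  On the double cover of the map whose vertex
  permutation and edge involution exchange the sheets, even degrees make the numbers of vertices,
  edges and faces double.  Euler's inequality \<open>V - E + F \<le> 2 K\<close> (\<open>euler_inequality\<close>), applied to the
  cover, then forces the number of components to double as well, so that the sheets of each component
  can be told apart, which is a colouring.
\<close>

section \<open>Joining two classes of an equivalence relation\<close>

definition merge :: "('a \<times> 'a) set \<Rightarrow> 'a \<Rightarrow> 'a \<Rightarrow> ('a \<times> 'a) set" where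
  "merge R a b = {(x, y). (x, y) \<in> R \<or> (x, a) \<in> R \<and> (b, y) \<in> R \<or> (x, b) \<in> R \<and> (a, y) \<in> R}"

lemma equiv_UNIV_iff: "equiv UNIV R \<longleftrightarrow> refl R \<and> sym R \<and> trans R"
  by (auto simp: equiv_def)

lemma equiv_merge: "equiv UNIV R \<Longrightarrow> equiv UNIV (merge R a b)"
  unfolding equiv_UNIV_iff merge_def refl_on_def sym_def trans_def by blast

lemma merge_trivial: "equiv UNIV R \<Longrightarrow> (a, b) \<in> R \<Longrightarrow> merge R a b = R"
  unfolding equiv_UNIV_iff merge_def refl_on_def sym_def trans_def by blast

lemma merge_upper: "equiv UNIV R \<Longrightarrow> R \<subseteq> merge R a b \<and> (a, b) \<in> merge R a b"
  unfolding equiv_UNIV_iff merge_def refl_on_def by blast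

lemma merge_least: "equiv UNIV E \<Longrightarrow> R \<subseteq> E \<Longrightarrow> (a, b) \<in> E \<Longrightarrow> merge R a b \<subseteq> E"
  unfolding equiv_UNIV_iff merge_def sym_def trans_def by blast

lemma card_merge:
  assumes R: "equiv UNIV R" and "finite H" "a \<in> H" "b \<in> H"
  shows "card (H // merge R a b) + (if (a, b) \<in> R then 0 else 1) = card (H // R)"
proof (cases "(a, b) \<in> R")
  case True
  then show ?thesis using merge_trivial[OF R] by simp
next
  case False
  let ?A = "R `` {a}" and ?B = "R `` {b}"
  have AB: "?A \<noteq> ?B" using False R by (simp add: eq_equiv_class_iff)
  define c where "c x = R `` {x}" for x
  have R_iff: "(x, y) \<in> R \<longleftrightarrow> c x = c y" for x y
    using R unfolding c_def by (simp add: equiv_class_eq_iff)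
  have cls: "merge R a b `` {x} = (if x \<in> ?A \<union> ?B then ?A \<union> ?B else R `` {x})" for x
  proof -
    have "(x, y) \<in> merge R a b \<longleftrightarrow> (if x \<in> ?A \<union> ?B then y \<in> ?A \<union> ?B else (x, y) \<in> R)" for y
      unfolding merge_def Image_singleton_iff Un_iff mem_Collect_eq case_prod_conv
      unfolding R_iff by auto
    then show ?thesis by (intro set_eqI) simp
  qed
  have eq: "R `` {x} = ?A \<or> R `` {x} = ?B" if "x \<in> ?A \<union> ?B" for x
    using that R by (auto simp: equiv_class_eq_iff)
  have in_eq: "x \<in> R `` {x}" for x
    by (simp add: R_iff)
  have "H // merge R a b = insert (?A \<union> ?B) (H // R - {?A, ?B})"
  proof (intro subset_antisym subsetI)
    fix C assume "C \<in> H // merge R a b"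
    then obtain x where "x \<in> H" "C = merge R a b `` {x}" by (auto simp: quotient_def)
    then show "C \<in> insert (?A \<union> ?B) (H // R - {?A, ?B})"
      using cls[of x] in_eq[of x] by (auto simp: quotient_def)
  next
    fix C assume C: "C \<in> insert (?A \<union> ?B) (H // R - {?A, ?B})"
    show "C \<in> H // merge R a b"
    proof (cases "C = ?A \<union> ?B")
      case True
      then have "C = merge R a b `` {a}" using cls[of a] in_eq[of a] by auto
      then show ?thesis using \<open>a \<in> H\<close> by (auto simp: quotient_def)
    next
      case False
      then obtain x where x: "x \<in> H" "C = R `` {x}" "C \<noteq> ?A" "C \<noteq> ?B"
        using C by (auto simp: quotient_def)
      then have "C = merge R a b `` {x}" using cls[of x] eq[of x] by metis
      then show ?thesis using x by (auto simp: quotient_def)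
    qed
  qed
  moreover have "?A \<union> ?B \<notin> H // R"
  proof
    assume "?A \<union> ?B \<in> H // R"
    then obtain x where "?A \<union> ?B = R `` {x}" by (auto simp: quotient_def)
    then have "a \<in> R `` {x}" "b \<in> R `` {x}" using in_eq[of a] in_eq[of b] by auto
    then show False using False R_iff by simp
  qed
  moreover have fin: "finite (H // R)" using \<open>finite H\<close> by (simp add: quotient_def)
  moreover have sub: "{?A, ?B} \<subseteq> H // R" using assms by (auto simp: quotient_def)
  moreover have "card (H // R) \<ge> 2"
    using card_mono[OF fin sub] AB by simp
  ultimately show ?thesis using False AB
    by (simp add: card_Diff_subset)
qed

fun merges :: "('a \<times> 'a) set \<Rightarrow> ('a \<times> 'a) list \<Rightarrow> ('a \<times> 'a) set" where
  "merges R [] = R"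
| "merges R ((a, b) # ps) = merges (merge R a b) ps"

lemma equiv_merges: "equiv UNIV R \<Longrightarrow> equiv UNIV (merges R ps)"
  by (induction R ps rule: merges.induct) (auto intro: equiv_merge)

lemma merges_upper: "equiv UNIV R \<Longrightarrow> R \<subseteq> merges R ps \<and> set ps \<subseteq> merges R ps"
proof (induction R ps rule: merges.induct)
  case (2 R a b ps)
  then show ?case using merge_upper[of R a b] equiv_merge[of R a b] by auto
qed simp

lemma merges_least: "equiv UNIV E \<Longrightarrow> R \<subseteq> E \<Longrightarrow> set ps \<subseteq> E \<Longrightarrow> merges R ps \<subseteq> E"
  by (induction R ps rule: merges.induct) (auto dest: merge_least)

section \<open>Euler's inequality\<close>

text \<open>The steps are confined to \<open>H\<close>, so that permutations of \<open>H\<close> may act arbitrarily elsewhere.\<close>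

definition reach :: "'a set \<Rightarrow> ('a \<Rightarrow> 'a) set \<Rightarrow> ('a \<times> 'a) set" where
  "reach H F = {(x, y). x \<in> H \<and> (\<exists>f\<in>F. y = f x)}\<^sup>*"

lemma reach_refl [simp]: "(x, x) \<in> reach H F"
  by (simp add: reach_def)

lemma reach_step: "x \<in> H \<Longrightarrow> f \<in> F \<Longrightarrow> (x, f x) \<in> reach H F"
  unfolding reach_def by blast

lemma reach_trans: "(x, y) \<in> reach H F \<Longrightarrow> (y, z) \<in> reach H F \<Longrightarrow> (x, z) \<in> reach H F"
  unfolding reach_def by (rule rtrancl_trans)

lemma reach_induct [consumes 1, case_names refl step]:
  assumes "(x, y) \<in> reach H F" "P x"
    "\<And>z f. (x, z) \<in> reach H F \<Longrightarrow> z \<in> H \<Longrightarrow> f \<in> F \<Longrightarrow> P z \<Longrightarrow> P (f z)"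
  shows "P y"
  using assms(1) unfolding reach_def
  by induction (use assms(2,3) in \<open>auto simp: reach_def\<close>)

lemma reach_closed:
  assumes "(x, y) \<in> reach H F" "x \<in> S" "\<And>z f. z \<in> S \<Longrightarrow> z \<in> H \<Longrightarrow> f \<in> F \<Longrightarrow> f z \<in> S"
  shows "y \<in> S"
  using assms(1) by (induction rule: reach_induct) (use assms in auto)

lemma reach_least:
  assumes "equiv UNIV E" "\<And>x f. x \<in> H \<Longrightarrow> f \<in> F \<Longrightarrow> (x, f x) \<in> E"
  shows "reach H F \<subseteq> E"
proof (rule subrelI)
  fix x y assume "(x, y) \<in> reach H F"
  then show "(x, y) \<in> E"
  proof (induction rule: reach_induct)
    case refl
    show ?case using assms(1) by (simp add: equiv_UNIV_iff refl_on_def)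
  next
    case (step z f)
    then show ?case using assms unfolding equiv_UNIV_iff by (blast dest: transD)
  qed
qed

text \<open>The inverse of a bijection of a finite set is one of its powers, so the relation is symmetric
  although its steps only go forwards.\<close>

lemma equiv_reach:
  assumes "finite H" and bij: "\<And>f. f \<in> F \<Longrightarrow> bij_betw f H H"
  shows "equiv UNIV (reach H F)"
proof -
  have rev_step: "(f x, x) \<in> reach H F" if "x \<in> H" "f \<in> F" for x f
  proof -
    let ?S = "reach H F `` {f x}"
    have fx: "f x \<in> H" using that bij bij_betwE by metis
    have S: "?S \<subseteq> H"
      using reach_closed[of "f x" _ H F H] fx bij by (auto dest: bij_betwE)
    moreover have "f ` ?S \<subseteq> ?S"
      using S that(2) reach_step[of _ H f F] by (auto intro: reach_trans)
    moreover have inj: "inj_on f H" using bij[OF that(2)] by (simp add: bij_betw_def)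
    ultimately have "f ` ?S = ?S"
      using \<open>finite H\<close> by (meson endo_inj_surj finite_subset inj_on_subset)
    then obtain z where "z \<in> ?S" "f z = f x"
      by (metis (no_types, lifting) Image_singleton_iff imageE reach_refl)
    then show ?thesis using inj S that by (auto dest: inj_onD)
  qed
  have "sym (reach H F)"
  proof (rule symI)
    fix x y assume "(x, y) \<in> reach H F"
    then show "(y, x) \<in> reach H F"
      by (induction rule: reach_induct) (use rev_step in \<open>auto intro: reach_trans\<close>)
  qed
  then show ?thesis
    unfolding equiv_UNIV_iff by (auto simp: refl_on_def trans_def intro: reach_trans)
qed

lemma reach_mono: "F \<subseteq> F' \<Longrightarrow> reach H F \<subseteq> reach H F'"
  unfolding reach_def by (rule rtrancl_mono) blast

lemma finite_reach_quotient: "finite H \<Longrightarrow> finite (H // R)"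
  by (simp add: quotient_def)

text \<open>Composing \<open>p\<close> with the transposition of \<open>a\<close> and \<open>b\<close> redirects only the steps from \<open>a\<close> and \<open>b\<close>,
  and the redirected steps differ from the old ones by a passage between \<open>a\<close> and \<open>b\<close>.  So the
  numbers of orbits of both permutations lie within one of each other.\<close>

lemma merge_reach_transpose:
  assumes "finite H" "bij_betw p H H" "a \<in> H" "b \<in> H"
  shows "merge (reach H {p \<circ> transpose a b}) a b \<subseteq> merge (reach H {p}) a b"
proof -
  let ?R = "reach H {p}"
  have R: "equiv UNIV ?R" using assms by (intro equiv_reach) auto
  note E = equiv_merge[OF R, of a b]
  have ab: "(a, b) \<in> merge ?R a b" and up: "?R \<subseteq> merge ?R a b"
    using merge_upper[OF R] by auto
  have st: "(x, p x) \<in> merge ?R a b" if "x \<in> H" for x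
    using up reach_step[OF that, of p "{p}"] by auto
  show ?thesis
  proof (rule merge_least[OF E _ ab], rule reach_least[OF E])
    fix x f assume x: "x \<in> H" "f \<in> {p \<circ> transpose a b}"
    have s: "(b, a) \<in> merge ?R a b" using E ab by (simp add: equiv_UNIV_iff sym_def)
    have t: "\<And>x y z. (x, y) \<in> merge ?R a b \<Longrightarrow> (y, z) \<in> merge ?R a b \<Longrightarrow> (x, z) \<in> merge ?R a b"
      using E unfolding equiv_UNIV_iff trans_def by blast
    show "(x, f x) \<in> merge ?R a b"
      using x st ab s t[of a b] t[of b a] assms by (auto simp: transpose_def)
  qed
qed

text \<open>After its first step from \<open>b\<close> to \<open>p a\<close> the new permutation follows the old orbit of \<open>a\<close>, which
  avoids \<open>b\<close>, until it arrives at \<open>a\<close>.\<close>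

lemma fuse_orbits:
  assumes "finite H" "bij_betw p H H" "a \<in> H" "b \<in> H" and ab: "(a, b) \<notin> reach H {p}"
  shows "(b, a) \<in> reach H {p \<circ> transpose a b}"
proof -
  define q where "q = p \<circ> transpose a b"
  let ?R = "reach H {p}" and ?Q = "reach H {q}"
  have R: "equiv UNIV ?R" using assms by (intro equiv_reach) auto
  have pa: "p a \<in> H" using assms bij_betwE by blast
  have "x \<in> H \<and> ((b, x) \<in> ?Q \<or> (b, a) \<in> ?Q)" if "(p a, x) \<in> ?R" for x
    using that
  proof (induction rule: reach_induct)
    case refl
    have "(b, q b) \<in> ?Q" using assms by (intro reach_step) auto
    moreover have "q b = p a" by (simp add: q_def)
    ultimately show ?case using pa by simp
  next
    case (step x f)
    have f: "f = p" and px: "p x \<in> H" using step.hyps assms bij_betwE by auto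
    show ?case
    proof (cases "x = a \<or> (b, a) \<in> ?Q")
      case True
      then show ?thesis using step.IH px f by auto
    next
      case False
      have "(a, p a) \<in> ?R" using assms by (auto intro: reach_step)
      then have "(a, x) \<in> ?R" using step.hyps(1) by (rule reach_trans)
      then have "x \<noteq> b" using ab by auto
      then have "q x = p x" using False by (simp add: q_def transpose_def)
      then have "(x, p x) \<in> ?Q" using reach_step[of x H q] step.hyps by auto
      moreover have "(b, x) \<in> ?Q" using step.IH False by blast
      ultimately have "(b, p x) \<in> ?Q" by (rule reach_trans[rotated])
      then show ?thesis using px f by blast
    qed
  qed
  moreover have "(p a, a) \<in> ?R"
    using R reach_step[of a H p "{p}"] assms by (auto simp: equiv_UNIV_iff sym_def)
  ultimately show ?thesis unfolding q_def by blast
qed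

text \<open>This is \<open>V - E + F \<le> 2 K\<close> with \<open>E\<close> replaced by half the number of darts.  The edges are added one
  at a time.  When only the darts in \<open>A\<close> are glued along edges, the faces are the orbits of
  \<open>r \<circ> g A\<close>, where \<open>g A\<close> is \<open>e\<close> on \<open>A\<close> and the identity elsewhere; so a new edge composes the face permutation with a transposition.  An edge within a
  component adds at most one face, which the term \<open>card A\<close> pays for.  An edge between two components
  loses a component but also fuses two faces.\<close>

lemma euler_inequality:
  assumes "finite H" and r: "bij_betw r H H" and eH: "\<And>x. x \<in> H \<Longrightarrow> e x \<in> H"
    and e: "\<And>x. x \<in> H \<Longrightarrow> e x \<noteq> x \<and> e (e x) = x"
  shows "2 * card (H // reach H {r}) + 2 * card (H // reach H {r \<circ> e})
      \<le> card H + 4 * card (H // reach H {r, e})"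
proof -
  define g where "g A x = (if x \<in> A then e x else x)" for A x
  have claim: "2 * card (H // reach H {r}) + 2 * card (H // reach H {r \<circ> g A})
      \<le> card A + 4 * card (H // reach H {r, g A})" if "A \<subseteq> H" "e ` A \<subseteq> A" for A
    using finite_subset[OF that(1) \<open>finite H\<close>] that
  proof (induction A rule: finite_psubset_induct)
    case (psubset A)
    have gbij: "bij_betw (g B) H H" if "B \<subseteq> H" "e ` B \<subseteq> B" for B
      by (rule bij_betw_byWitness[where f' = "g B"])
        (use that e eH in \<open>auto simp: g_def\<close>)
    show ?case
    proof (cases "A = {}")
      case True
      have "r \<circ> g {} = r" by (auto simp: g_def)
      moreover have "reach H {r} \<subseteq> reach H {r, g {}}" by (rule reach_mono) auto
      moreover have "reach H {r, g {}} \<subseteq> reach H {r}"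
        by (rule reach_least) (auto simp: g_def intro: equiv_reach assms reach_step)
      ultimately show ?thesis using True by simp
    next
      case False
      then obtain a where a: "a \<in> A" by auto
      define b where "b = e a"
      define B where "B = A - {a, b}"
      have ab: "a \<in> H" "b \<in> H" "a \<noteq> b" "b \<in> A" "e b = a"
        using a psubset.prems e unfolding b_def by (auto simp: eq_commute)
      have B: "B \<subset> A" "B \<subseteq> H" using a psubset.prems by (auto simp: B_def)
      have eB: "e ` B \<subseteq> B"
      proof
        fix y assume "y \<in> e ` B"
        then obtain x where x: "y = e x" "x \<in> A" "x \<noteq> a" "x \<noteq> b" by (auto simp: B_def)
        then have "e y = x" "y \<in> A" using psubset.prems e by auto
        then show "y \<in> B" using x ab b_def by (auto simp: B_def)
      qed
      let ?p = "r \<circ> g B" and ?q = "r \<circ> g A"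
      have gA: "g A = g B \<circ> transpose a b"
      proof
        fix x show "g A x = (g B \<circ> transpose a b) x"
          using a ab by (auto simp: g_def B_def transpose_def b_def)
      qed
      then have q: "?q = ?p \<circ> transpose a b" by (simp add: comp_assoc)
      then have p: "?p = ?q \<circ> transpose a b" by (simp add: comp_assoc)
      have pbij: "bij_betw ?p H H" and qbij: "bij_betw ?q H H"
        using gbij[OF B(2) eB] gbij[OF psubset.prems] r by (auto intro: bij_betw_trans)
      let ?P = "reach H {?p}" and ?Q = "reach H {?q}"
      let ?KA = "reach H {r, g A}" and ?KB = "reach H {r, g B}"
      have P: "equiv UNIV ?P" and Q: "equiv UNIV ?Q"
        using pbij qbij \<open>finite H\<close> by (auto intro: equiv_reach)
      have KA: "equiv UNIV ?KA" and KB: "equiv UNIV ?KB"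
        using gbij[OF B(2) eB] gbij[OF psubset.prems] r \<open>finite H\<close> by (auto intro!: equiv_reach)
      have PQ: "merge ?P a b = merge ?Q a b"
        using merge_reach_transpose[OF \<open>finite H\<close> qbij ab(1,2), folded p]
          merge_reach_transpose[OF \<open>finite H\<close> pbij ab(1,2), folded q] by (rule subset_antisym)
      have pq: "card (H // ?P) + (if (a, b) \<in> ?Q then 0 else 1) =
          card (H // ?Q) + (if (a, b) \<in> ?P then 0 else 1)"
        using card_merge[OF P \<open>finite H\<close> ab(1,2), unfolded PQ]
          card_merge[OF Q \<open>finite H\<close> ab(1,2)] by linarith
      have K: "?KA = merge ?KB a b"
      proof
        note M = merge_upper[OF KB, of a b]
        have Msym: "(b, a) \<in> merge ?KB a b"
          using M equiv_merge[OF KB] by (auto simp: equiv_UNIV_iff sym_def)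
        show "?KA \<subseteq> merge ?KB a b"
        proof (rule reach_least[OF equiv_merge[OF KB]])
          fix x f assume x: "x \<in> H" "f \<in> {r, g A}"
          have "(x, r x) \<in> ?KB" "(x, g B x) \<in> ?KB" using x(1) by (auto intro: reach_step)
          then have st: "(x, r x) \<in> merge ?KB a b" "(x, g B x) \<in> merge ?KB a b" using M by blast+
          have "x = a \<or> x = b \<or> g A x = g B x" by (auto simp: g_def B_def)
          then consider "x = a" | "x = b" | "g A x = g B x" by blast
          moreover have "g A a = b" "g A b = a" using a ab by (auto simp: g_def b_def)
          ultimately have "(x, g A x) \<in> merge ?KB a b"
            by cases (use M Msym st(2) in simp_all)
          then show "(x, f x) \<in> merge ?KB a b" using x(2) st(1) by blast
        qed
        have "(a, g A a) \<in> ?KA" using ab by (intro reach_step) auto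
        then have "(a, b) \<in> ?KA" using a by (simp add: g_def b_def)
        moreover have "?KB \<subseteq> ?KA"
        proof (rule reach_least[OF KA])
          fix x f assume x: "x \<in> H" "f \<in> {r, g B}"
          have st: "(x, r x) \<in> ?KA" "(x, g A x) \<in> ?KA" using x(1) by (auto intro: reach_step)
          have "g B x = x \<or> g B x = g A x" by (auto simp: g_def B_def)
          then have "(x, g B x) \<in> ?KA" using st(2) by (elim disjE) simp_all
          then show "(x, f x) \<in> ?KA" using x(2) st(1) by blast
        qed
        ultimately show "merge ?KB a b \<subseteq> ?KA" by (rule merge_least[OF KA, rotated])
      qed
      have cA: "card A = card B + 2"
      proof -
        have "finite A" using psubset.hyps by simp
        then show ?thesis using a ab card_mono[of A "{a, b}"] unfolding B_def
          by (subst card_Diff_subset) auto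
      qed
      note IH = psubset.IH[OF B(1,2) eB]
      note cK = card_merge[OF KB \<open>finite H\<close> ab(1,2), folded K]
      show ?thesis
      proof (cases "(a, b) \<in> ?KB")
        case True
        then have "card (H // ?KA) = card (H // ?KB)" using cK by simp
        moreover have "(if (a, b) \<in> ?Q then 0 else 1) \<le> (1::nat)" by simp
        ultimately show ?thesis using IH pq cA by linarith
      next
        case False
        have "?P \<subseteq> ?KB"
        proof (rule reach_least[OF KB])
          fix x f assume x: "x \<in> H" "f \<in> {?p}"
          then have "g B x \<in> H" using gbij[OF B(2) eB] bij_betwE by blast
          then have "(x, g B x) \<in> ?KB" "(g B x, r (g B x)) \<in> ?KB"
            using x by (auto intro: reach_step)
          then have "(x, r (g B x)) \<in> ?KB" by (rule reach_trans)
          then show "(x, f x) \<in> ?KB" using x(2) by simp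
        qed
        then have nab: "(a, b) \<notin> ?P" using False by auto
        then have "(b, a) \<in> ?Q"
          using fuse_orbits[OF \<open>finite H\<close> pbij ab(1,2), folded q] by blast
        then have "(a, b) \<in> ?Q" using Q by (simp add: equiv_UNIV_iff sym_def)
        then have "card (H // ?P) = card (H // ?Q) + 1" using pq nab by simp
        moreover have "card (H // ?KA) + 1 = card (H // ?KB)" using cK False by simp
        ultimately show ?thesis using IH cA by linarith
      qed
    qed
  qed
  have "g H x = e x" if "x \<in> H" for x using that by (simp add: g_def)
  then have "reach H {r \<circ> g H} = reach H {r \<circ> e}" "reach H {r, g H} = reach H {r, e}"
    unfolding reach_def by (auto intro!: arg_cong[where f = rtrancl])
  then show ?thesis using claim[of H] eH by auto
qed

section \<open>Orbits as classes\<close>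

lemma orbit_eq_reach:
  assumes "finite H" and f: "bij_betw f H H" and "x \<in> H"
  shows "orbit f x = reach H {f} `` {x}"
proof (intro subset_antisym subsetI)
  fix y assume "y \<in> orbit f x"
  then have "y \<in> H \<and> (x, y) \<in> reach H {f}"
  proof induction
    case base
    then show ?case using \<open>x \<in> H\<close> f by (auto intro: reach_step dest: bij_betwE)
  next
    case (step y)
    then have "(y, f y) \<in> reach H {f}" by (intro reach_step) auto
    then show ?case using step.IH f by (auto intro: reach_trans dest: bij_betwE)
  qed
  then show "y \<in> reach H {f} `` {x}" by simp
next
  fix y assume y: "y \<in> reach H {f} `` {x}"
  have "equiv UNIV (reach H {f})" using assms by (intro equiv_reach) auto
  moreover have "(x, f x) \<in> reach H {f}" using \<open>x \<in> H\<close> by (intro reach_step) auto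
  ultimately have "(f x, y) \<in> reach H {f}"
    using y unfolding equiv_UNIV_iff by (auto intro: reach_trans dest: symD)
  then show "y \<in> orbit f x"
    by (induction rule: reach_induct) (auto intro: orbit.intros)
qed

lemma orbits_eq_reach:
  assumes "finite H" "bij_betw f H H"
  shows "orbit f ` H = H // reach H {f}"
  using orbit_eq_reach[OF assms] by (auto simp: quotient_def)

lemma card_orbits:
  assumes "finite H" and f: "bij_betw f H H" and k: "\<And>x. x \<in> H \<Longrightarrow> card (orbit f x) = k"
  shows "k * card (orbit f ` H) = card H"
proof -
  let ?R = "reach H {f}"
  have R: "equiv UNIV ?R" using assms by (intro equiv_reach) auto
  have sub: "y \<in> H" if "x \<in> H" "y \<in> orbit f x" for x y
    using that reach_closed[of x y H "{f}" H] orbit_eq_reach[OF assms(1,2)] f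
    by (auto dest: bij_betwE)
  have self: "x \<in> orbit f x" if "x \<in> H" for x
    using that orbit_eq_reach[OF assms(1,2)] by simp
  then have "\<Union> (orbit f ` H) = H" using sub by blast
  moreover have "c \<inter> c' = {}" if "c \<in> orbit f ` H" "c' \<in> orbit f ` H" "c \<noteq> c'" for c c'
    using that quotient_disj[OF R, of c c'] unfolding orbits_eq_reach[OF assms(1,2)]
    by (auto simp: quotient_def)
  ultimately show ?thesis
    using \<open>finite H\<close> k card_partition[of "orbit f ` H" k] by (metis finite_imageI imageE)
qed

section \<open>Double covers of maps\<close>

text \<open>The sheets of the cover \<open>H \<times> UNIV\<close> are indexed by \<open>bool\<close>.  For \<open>s = Not\<close> every function of \<open>F\<close>
  exchanges them, for \<open>s = id\<close> the cover is trivial.\<close>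

definition lift :: "(bool \<Rightarrow> bool) \<Rightarrow> ('a \<Rightarrow> 'a) set \<Rightarrow> ('a \<times> bool \<Rightarrow> 'a \<times> bool) set" where
  "lift s F = (\<lambda>f. map_prod f s) ` F"

lemma reach_project:
  assumes "((x, i), (y, j)) \<in> reach (H \<times> UNIV) (lift s F)"
  shows "(x, y) \<in> reach H F"
proof -
  have "(fst (x, i), fst (y, j)) \<in> reach H F"
    using assms
  proof (induction rule: reach_induct)
    case (step z f)
    then obtain g where "g \<in> F" "fst z \<in> H" "fst (f z) = g (fst z)"
      by (auto simp: lift_def map_prod_def split: prod.splits)
    then have "(fst z, fst (f z)) \<in> reach H F" by (metis reach_step)
    with step.IH show ?case by (rule reach_trans)
  qed simp
  then show ?thesis by simp
qed

lemma reach_lift: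
  assumes "(x, y) \<in> reach H F"
  shows "\<exists>j. ((x, i), (y, j)) \<in> reach (H \<times> UNIV) (lift s F)"
  using assms
proof (induction rule: reach_induct)
  case (step z f)
  then obtain j where j: "((x, i), (z, j)) \<in> reach (H \<times> UNIV) (lift s F)" by blast
  have "((z, j), map_prod f s (z, j)) \<in> reach (H \<times> UNIV) (lift s F)"
    using step.hyps by (intro reach_step) (auto simp: lift_def)
  with j have "((x, i), map_prod f s (z, j)) \<in> reach (H \<times> UNIV) (lift s F)"
    by (rule reach_trans)
  then show ?case by auto
qed (blast intro: reach_refl)

text \<open>Exchanging the sheets commutes with all lifted functions: it is a deck transformation.\<close>

lemma reach_deck:
  assumes "((x, i), (y, j)) \<in> reach (H \<times> UNIV) (lift s F)" and s: "s = id \<or> s = Not"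
  shows "((x, \<not> i), (y, \<not> j)) \<in> reach (H \<times> UNIV) (lift s F)"
proof -
  let ?d = "map_prod id Not"
  have "(?d (x, i), ?d (y, j)) \<in> reach (H \<times> UNIV) (lift s F)"
    using assms(1)
  proof (induction rule: reach_induct)
    case (step z f)
    then obtain g where g: "g \<in> F" "f = map_prod g s" by (auto simp: lift_def)
    have "(?d z, f (?d z)) \<in> reach (H \<times> UNIV) (lift s F)"
      using step.hyps by (intro reach_step) (auto simp: map_prod_def split: prod.splits)
    moreover have "f (?d z) = ?d (f z)" using g s by (cases z) auto
    ultimately have "(?d z, ?d (f z)) \<in> reach (H \<times> UNIV) (lift s F)" by simp
    with step.IH show ?case by (rule reach_trans)
  qed simp
  then show ?thesis by simp
qed

text \<open>Over each class lie at most two classes, those of the two lifts of a base point.  Counting classes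
  therefore decides whether the two lifts of a point can be connected.\<close>

context
  fixes H :: "'a set" and F :: "('a \<Rightarrow> 'a) set" and s :: "bool \<Rightarrow> bool"
  assumes fin: "finite H" and bij: "\<And>f. f \<in> F \<Longrightarrow> bij_betw f H H" and s: "s = id \<or> s = Not"
begin

private definition base_point :: "'a set \<Rightarrow> 'a" where
  "base_point C = (SOME x. x \<in> C)"

private definition lifted_class :: "'a set \<times> bool \<Rightarrow> ('a \<times> bool) set" where
  "lifted_class = (\<lambda>(C, i). reach (H \<times> UNIV) (lift s F) `` {(base_point C, i)})"

lemma equiv_base: "equiv UNIV (reach H F)"
  using fin bij by (rule equiv_reach)

lemma bij_lift: "g \<in> lift s F \<Longrightarrow> bij_betw g (H \<times> UNIV) (H \<times> UNIV)"
proof -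
  assume "g \<in> lift s F"
  then obtain f where f: "f \<in> F" "g = map_prod f s" by (auto simp: lift_def)
  have "bij_betw s UNIV UNIV" using s by (auto intro!: bij_betw_byWitness[where f' = s])
  then show ?thesis using f bij by (auto intro: bij_betw_map_prod)
qed

lemma equiv_cover: "equiv UNIV (reach (H \<times> UNIV) (lift s F))"
  using fin bij_lift by (intro equiv_reach) auto

private lemma base_point: "C \<in> H // reach H F \<Longrightarrow> base_point C \<in> H \<and> reach H F `` {base_point C} = C"
proof -
  assume "C \<in> H // reach H F"
  then obtain x where x: "x \<in> H" "C = reach H F `` {x}" by (auto simp: quotient_def)
  then have "base_point C \<in> C" unfolding base_point_def by (metis Image_singleton_iff reach_refl someI)
  then have xb: "(x, base_point C) \<in> reach H F" using x by auto
  then have "base_point C \<in> H"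
    using reach_closed[of x _ H F H] x bij by (auto dest: bij_betwE)
  then show ?thesis using x xb equiv_base by (metis UNIV_I equiv_class_eq_iff)
qed

private lemma lifted_class_onto: "(H \<times> UNIV) // reach (H \<times> UNIV) (lift s F) \<subseteq> lifted_class ` ((H // reach H F) \<times> UNIV)"
proof
  fix B assume "B \<in> (H \<times> UNIV) // reach (H \<times> UNIV) (lift s F)"
  then obtain x i where x: "x \<in> H" "B = reach (H \<times> UNIV) (lift s F) `` {(x, i)}"
    by (auto simp: quotient_def)
  define C where "C = reach H F `` {x}"
  have C: "C \<in> H // reach H F" using x by (auto simp: C_def quotient_def)
  then have "(x, base_point C) \<in> reach H F"
    using base_point[OF C] equiv_base C_def by (metis UNIV_I equiv_class_eq_iff)
  then obtain j where "((x, i), (base_point C, j)) \<in> reach (H \<times> UNIV) (lift s F)"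
    using reach_lift by metis
  then have "B = lifted_class (C, j)"
    using x equiv_cover unfolding lifted_class_def by (simp add: equiv_class_eq_iff)
  then show "B \<in> lifted_class ` ((H // reach H F) \<times> UNIV)" using C by auto
qed

private lemma lifted_class_eq_iff:
  "lifted_class (C, i) = lifted_class (C', j) \<longleftrightarrow>
    ((base_point C, i), (base_point C', j)) \<in> reach (H \<times> UNIV) (lift s F)"
  using equiv_cover unfolding lifted_class_def by (simp add: eq_equiv_class_iff)

lemma split_cover:
  assumes "\<And>x. x \<in> H \<Longrightarrow> ((x, True), (x, False)) \<notin> reach (H \<times> UNIV) (lift s F)"
  shows "2 * card (H // reach H F) \<le> card ((H \<times> UNIV) // reach (H \<times> UNIV) (lift s F))"
proof -
  have "inj_on lifted_class ((H // reach H F) \<times> UNIV)"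
  proof (rule inj_onI, clarify)
    fix C C' i j assume C: "C \<in> H // reach H F" "C' \<in> H // reach H F"
      and eq: "lifted_class (C, i) = lifted_class (C', j)"
    then have con: "((base_point C, i), (base_point C', j)) \<in> reach (H \<times> UNIV) (lift s F)"
      by (simp add: lifted_class_eq_iff)
    then have "(base_point C, base_point C') \<in> reach H F" by (rule reach_project)
    then have CC: "C = C'"
      using base_point C equiv_base by (metis UNIV_I equiv_class_eq_iff)
    moreover have "i = j"
    proof (rule ccontr)
      assume "i \<noteq> j"
      then have "((base_point C, True), (base_point C, False)) \<in> reach (H \<times> UNIV) (lift s F)"
        using con CC reach_deck[OF con s] by (cases i; cases j) auto
      then show False using assms base_point C by blast
    qed
    ultimately show "C = C' \<and> i = j" by simp
  qed
  moreover have "lifted_class ` ((H // reach H F) \<times> UNIV) \<subseteq> (H \<times> UNIV) // reach (H \<times> UNIV) (lift s F)"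
    using base_point by (auto simp: lifted_class_def quotient_def)
  moreover have "finite ((H \<times> (UNIV :: bool set)) // reach (H \<times> UNIV) (lift s F))"
    using fin by (intro finite_reach_quotient) auto
  ultimately have "card ((H // reach H F) \<times> (UNIV :: bool set)) \<le> card ((H \<times> UNIV) // reach (H \<times> UNIV) (lift s F))"
    by (rule card_inj_on_le)
  then show ?thesis by (simp add: card_cartesian_product)
qed

lemma cover_splits:
  assumes "2 * card (H // reach H F) \<le> card ((H \<times> UNIV) // reach (H \<times> UNIV) (lift s F))"
    and "x \<in> H"
  shows "((x, True), (x, False)) \<notin> reach (H \<times> UNIV) (lift s F)"
proof
  let ?A = "(H // reach H F) \<times> (UNIV :: bool set)"
  assume xx: "((x, True), (x, False)) \<in> reach (H \<times> UNIV) (lift s F)"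
  have fin_A: "finite ?A" using finite_reach_quotient[OF fin] by auto
  have "card ?A \<le> card (lifted_class ` ?A)"
    using assms(1) card_mono[OF finite_imageI[OF fin_A] lifted_class_onto] by (simp add: card_cartesian_product)
  then have inj: "inj_on lifted_class ?A"
    using card_image_le[OF fin_A, of lifted_class] eq_card_imp_inj_on[OF fin_A, of lifted_class] by simp
  define C where "C = reach H F `` {x}"
  have C: "C \<in> H // reach H F" using assms(2) by (auto simp: C_def quotient_def)
  then have "(x, base_point C) \<in> reach H F"
    using base_point[OF C] equiv_base C_def by (metis UNIV_I equiv_class_eq_iff)
  then obtain j where j: "((x, True), (base_point C, j)) \<in> reach (H \<times> UNIV) (lift s F)"
    using reach_lift by metis
  then have j': "((x, False), (base_point C, \<not> j)) \<in> reach (H \<times> UNIV) (lift s F)"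
    using reach_deck[OF j s] by simp
  have "lifted_class (C, j) = lifted_class (C, \<not> j)"
    unfolding lifted_class_eq_iff
    using equiv_cover j reach_trans[OF xx j'] by (meson equiv_UNIV_iff reach_trans symD)
  then show False using inj C by (auto dest: inj_onD)
qed

end

section \<open>Planar maps with even degrees\<close>

text \<open>Both \<open>r\<close> and \<open>e\<close> change the colour of a dart, so \<open>r \<circ> e\<close> preserves it: the colour belongs to a
  face, and the two sides of an edge have different colours.  In the double cover on which \<open>r\<close> and
  \<open>e\<close> exchange the sheets, the orbits of \<open>r\<close> lift to two orbits because they are even, those of
  \<open>r \<circ> e\<close> because the two exchanges cancel, and the number of darts doubles.  Since the map
  satisfies Euler's formula, Euler's inequality for the cover says that there are at least twice as
  many components; so no two lifts of a dart are connected, and the colour of a dart tells which of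
  its lifts is connected to a chosen lift of a base point.\<close>

theorem checkerboard_colouring:
  assumes fin: "finite H" and r: "bij_betw r H H" and eH: "\<And>x. x \<in> H \<Longrightarrow> e x \<in> H"
    and e: "\<And>x. x \<in> H \<Longrightarrow> e x \<noteq> x \<and> e (e x) = x"
    and even_degree: "\<And>x n. x \<in> H \<Longrightarrow> (r ^^ n) x = x \<Longrightarrow> even n"
    and planar: "planar_map H e r"
  obtains c :: "'a \<Rightarrow> bool" where "\<And>x. x \<in> H \<Longrightarrow> c (e x) \<noteq> c x \<and> c (r x) \<noteq> c x"
proof -
  have ebij: "bij_betw e H H"
    by (rule bij_betw_byWitness[where f' = e]) (use e eH in auto)
  then have re: "bij_betw (r \<circ> e) H H" using r by (rule bij_betw_trans)
  let ?F = "{r, e}" let ?H = "H \<times> (UNIV :: bool set)" let ?R = "reach ?H (lift Not ?F)"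
  have bij: "bij_betw f H H" if "f \<in> ?F" for f using that r ebij by auto
  have "orbit e x = {x, e x}" if "x \<in> H" for x
  proof -
    have "e x \<in> orbit e x" "e (e x) \<in> orbit e x" by (auto intro: orbit.intros)
    moreover have "y \<in> orbit e x \<Longrightarrow> y \<in> {x, e x}" for y
      by (induction rule: orbit.induct) (use e that in auto)
    ultimately show ?thesis using e that by auto
  qed
  then have E: "2 * card (orbit e ` H) = card H"
    using e by (intro card_orbits[OF fin ebij]) (metis card_2_iff)
  have "{(x, y). y = e x \<or> y = r x}\<^sup>* `` {x} = reach H ?F `` {x}" if "x \<in> H" for x
  proof (intro subset_antisym subsetI)
    fix y assume "y \<in> {(x, y). y = e x \<or> y = r x}\<^sup>* `` {x}"
    then have "(x, y) \<in> {(x, y). y = e x \<or> y = r x}\<^sup>*" by simp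
    then have "y \<in> H \<and> (x, y) \<in> reach H ?F"
    proof induction
      case (step y z)
      then have "(y, z) \<in> reach H ?F" by (auto intro: reach_step)
      then show ?case using step eH r by (auto intro: reach_trans dest: bij_betwE)
    qed (use that in simp)
    then show "y \<in> reach H ?F `` {x}" by simp
  next
    fix y assume "y \<in> reach H ?F `` {x}"
    moreover have "reach H ?F \<subseteq> {(x, y). y = e x \<or> y = r x}\<^sup>*"
      unfolding reach_def by (rule rtrancl_mono) auto
    ultimately show "y \<in> {(x, y). y = e x \<or> y = r x}\<^sup>* `` {x}" by auto
  qed
  then have K: "H // {(x, y). y = e x \<or> y = r x}\<^sup>* = H // reach H ?F"
    by (auto simp: quotient_def)
  have pl: "2 * card (H // reach H {r}) + 2 * card (H // reach H {r \<circ> e}) = card H + 4 * card (H // reach H ?F)"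
    using planar E unfolding planar_map_def K
    unfolding orbits_eq_reach[OF fin r] orbits_eq_reach[OF fin re] by simp
  have "2 * card (H // reach H {r}) \<le> card (?H // reach ?H (lift Not {r}))"
  proof (rule split_cover[OF fin])
    fix x assume x: "x \<in> H"
    have "\<exists>n. y = (r ^^ n) x \<and> (i \<longleftrightarrow> even n)" if "((x, True), (y, i)) \<in> reach ?H (lift Not {r})" for y i
    proof -
      have "\<exists>n. (y, i) = ((r ^^ n) x, even n)"
        using that
      proof (induction rule: reach_induct)
        case refl
        then show ?case by (intro exI[of _ 0]) simp
      next
        case (step z f)
        then obtain n where "z = ((r ^^ n) x, even n)" by blast
        then show ?case using step.hyps by (intro exI[of _ "Suc n"]) (auto simp: lift_def)
      qed
      then show ?thesis by auto
    qed
    then show "((x, True), (x, False)) \<notin> reach ?H (lift Not {r})"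
      using even_degree[OF x] by metis
  qed (use r in auto)
  moreover have "2 * card (H // reach H {r \<circ> e}) \<le> card (?H // reach ?H (lift id {r \<circ> e}))"
  proof (rule split_cover[OF fin])
    fix x assume x: "x \<in> H"
    have "snd z = True" if "((x, True), z) \<in> reach ?H (lift id {r \<circ> e})" for z
      using that by (induction rule: reach_induct) (auto simp: lift_def)
    then show "((x, True), (x, False)) \<notin> reach ?H (lift id {r \<circ> e})" by fastforce
  qed (use re in auto)
  moreover have "lift id {r \<circ> e} = {map_prod r Not \<circ> map_prod e Not}"
    by (auto simp: lift_def fun_eq_iff)
  moreover have "lift Not {r} = {map_prod r Not}" "lift Not ?F = {map_prod r Not, map_prod e Not}"
    by (auto simp: lift_def)
  moreover have "2 * card (?H // reach ?H {map_prod r Not}) + 2 * card (?H // reach ?H {map_prod r Not \<circ> map_prod e Not})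
      \<le> card ?H + 4 * card (?H // reach ?H {map_prod r Not, map_prod e Not})"
    using fin bij_lift[OF fin bij, where s = Not and g = "map_prod r Not"] eH e
    by (intro euler_inequality) (auto simp: lift_def)
  moreover have "card ?H = 2 * card H" by (simp add: card_cartesian_product)
  ultimately have le: "2 * card (H // reach H ?F) \<le> card (?H // ?R)" using pl by simp
  have apart: "((x, True), (x, False)) \<notin> ?R" if "x \<in> H" for x
    by (rule cover_splits[OF fin bij _ le that]) auto
  have eqR: "equiv UNIV ?R" by (rule equiv_cover[OF fin bij]) auto
  have eqB: "equiv UNIV (reach H ?F)" by (rule equiv_reach[OF fin bij])
  \<comment> \<open>a base point that depends only on the component of \<open>x\<close>\<close>
  define b where "b x = (SOME y. y \<in> reach H ?F `` {x})" for x
  have b: "(b x, x) \<in> reach H ?F" for x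
  proof -
    have "b x \<in> reach H ?F `` {x}" unfolding b_def by (metis Image_singleton_iff reach_refl someI)
    then show ?thesis using eqB by (auto simp: equiv_UNIV_iff dest: symD)
  qed
  define c where "c x \<longleftrightarrow> ((b x, True), (x, True)) \<in> ?R" for x
  have c: "c (f x) \<noteq> c x" if x: "x \<in> H" and f: "f \<in> ?F" for x f
  proof -
    have "(x, f x) \<in> reach H ?F" using that by (rule reach_step)
    then have bf: "b (f x) = b x" using eqB unfolding b_def by (metis UNIV_I equiv_class_eq_iff)
    have fx: "f x \<in> H" using bij[OF f] x by (auto dest: bij_betwE)
    have st: "((x, i), (f x, \<not> i)) \<in> ?R" for i
      using reach_step[of "(x, i)" ?H "map_prod f Not" "lift Not ?F"] x f by (auto simp: lift_def)
    obtain j where j: "((b x, True), (x, j)) \<in> ?R" using reach_lift[OF b] by metis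
    then have j': "((b x, True), (f x, \<not> j)) \<in> ?R" using st by (rule reach_trans)
    have uniq: "k = l" if "y \<in> H" "((b x, True), (y, k)) \<in> ?R" "((b x, True), (y, l)) \<in> ?R" for y k l
    proof (rule ccontr)
      assume "k \<noteq> l"
      moreover have "((y, k), (y, l)) \<in> ?R" "((y, l), (y, k)) \<in> ?R"
        using that eqR by (meson equiv_UNIV_iff reach_trans symD)+
      ultimately show False using apart[OF that(1)] by (cases k; cases l) auto
    qed
    show ?thesis unfolding c_def bf using uniq[OF x j] uniq[OF fx j'] j j' by (cases j) auto
  qed
  show thesis by (rule that[of c]) (use c in auto)
qed

section \<open>Diagrams and disks\<close>

lemma orbit_period:
  assumes "x \<in> orbit f x"
  shows "(f ^^ card (orbit f x)) x = x"
    and "(f ^^ n) x = x \<Longrightarrow> card (orbit f x) dvd n"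
proof -
  let ?k = "funpow_dist1 f x x"
  have k: "card (orbit f x) = ?k"
    using orbit_conv_funpow_dist1[OF assms] inj_on_funpow_dist1[OF assms]
    by (metis card_atLeastLessThan card_image diff_zero)
  show 1: "(f ^^ card (orbit f x)) x = x"
    unfolding k using assms by (rule funpow_dist1_prop)
  assume n: "(f ^^ n) x = x"
  have "(f ^^ (n mod ?k)) x = x"
    using n 1 k by (metis funpow_mod_eq)
  then have "n mod ?k = 0"
    using funpow_dist1_least[of "n mod ?k" f x x] by fastforce
  then show "card (orbit f x) dvd n" unfolding k by auto
qed

locale disk_in_diagram =
  fixes D :: "'d diagram" and I :: "'d set" and bs :: "'d list"
  assumes link: "link_diagram D" and disk: "disk D I bs"
begin

abbreviation outside :: "'d set" where "outside \<equiv> darts D - I"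

lemma finite_darts: "finite (darts D)"
  using link by (simp add: link_diagram_def)

lemma edge_in: "d \<in> darts D \<Longrightarrow> edge D d \<in> darts D"
  using link permutes_in_image by (fastforce simp: link_diagram_def)

lemma edge_edge: "d \<in> darts D \<Longrightarrow> edge D (edge D d) = d"
  using link by (simp add: link_diagram_def)

lemma edge_neq: "d \<in> darts D \<Longrightarrow> edge D d \<noteq> d"
  using link by (simp add: link_diagram_def)

lemma rot_permutes: "rot D permutes darts D"
  using link by (simp add: link_diagram_def)

lemma rot_in: "rot D d \<in> darts D \<longleftrightarrow> d \<in> darts D"
  using rot_permutes by (rule permutes_in_image)

lemma inv_rot_in: "inv (rot D) d \<in> darts D \<longleftrightarrow> d \<in> darts D"
  using permutes_inv[OF rot_permutes] by (rule permutes_in_image)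

lemma inv_rot [simp]: "inv (rot D) (rot D d) = d" "rot D (inv (rot D) d) = d"
  using permutes_inverses[OF rot_permutes] by auto

lemma rot_inj: "rot D d = rot D d' \<longleftrightarrow> d = d'"
  using permutes_inj[OF rot_permutes] by (simp add: inj_eq)

lemma permutation_rot: "permutation (rot D)"
  using finite_darts rot_permutes by (rule permutation_permutes[THEN iffD2, OF exI, OF conjI])

lemma card_orbit_rot: "d \<in> darts D \<Longrightarrow> card (orbit (rot D) d) \<in> {2, 4}"
  using link by (simp add: link_diagram_def)

lemma rot_period: "(rot D ^^ card (orbit (rot D) d)) d = d"
    "(rot D ^^ n) d = d \<Longrightarrow> card (orbit (rot D) d) dvd n"
  using orbit_period[OF permutation_self_in_orbit[OF permutation_rot]] by auto

lemma crossing_rot [simp]: "rot D d \<in> crossing_darts D \<longleftrightarrow> d \<in> crossing_darts D"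
  using permutation_orbit_step[OF permutation_rot] rot_in by (auto simp: crossing_darts_def)

lemma crossing_inv_rot [simp]: "inv (rot D) d \<in> crossing_darts D \<longleftrightarrow> d \<in> crossing_darts D"
  using crossing_rot[of "inv (rot D) d"] by simp

lemma rot_crossing: "d \<in> crossing_darts D \<Longrightarrow> rot D (rot D (rot D (rot D d))) = d"
  using rot_period(1)[of d] by (simp add: crossing_darts_def eval_nat_numeral)

lemma rot_noncrossing: "d \<in> darts D \<Longrightarrow> d \<notin> crossing_darts D \<Longrightarrow> rot D (rot D d) = d"
  using rot_period(1)[of d] card_orbit_rot[of d] by (auto simp: crossing_darts_def eval_nat_numeral)

lemma over_rot: "d \<in> crossing_darts D \<Longrightarrow> rot D d \<in> over D \<longleftrightarrow> d \<notin> over D"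
  using link by (simp add: link_diagram_def)

lemma over_inv_rot: "d \<in> crossing_darts D \<Longrightarrow> inv (rot D) d \<in> over D \<longleftrightarrow> d \<notin> over D"
  using over_rot[of "inv (rot D) d"] by auto

lemma resolve_in: "d \<in> darts D \<Longrightarrow> resolve D X d \<in> darts D"
  by (simp add: resolve_def rot_in inv_rot_in)

lemma resolve_noncrossing: "d \<notin> crossing_darts D \<Longrightarrow> resolve D X d = rot D d"
  by (simp add: resolve_def)

lemma resolve_resolve: "d \<in> darts D \<Longrightarrow> resolve D X (resolve D X d) = d"
  by (auto simp: resolve_def rot_noncrossing over_rot over_inv_rot)

lemma inside_darts: "I \<subseteq> darts D"
  using disk by (simp add: disk_def)

lemma boundary_inside: "set bs \<subseteq> I"
  using disk by (auto simp: disk_def)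

lemma distinct_boundary: "distinct bs"
  using disk by (auto simp: disk_def)

lemma boundary_noncrossing: "p \<in> set bs \<Longrightarrow> p \<notin> crossing_darts D"
  using disk by (auto simp: disk_def)

lemma rot_inside: "d \<in> I \<Longrightarrow> rot D d \<in> I \<longleftrightarrow> d \<notin> set bs"
  using disk by (auto simp: disk_def)

lemma edge_inside: "d \<in> darts D \<Longrightarrow> edge D d \<in> I \<longleftrightarrow> d \<in> I"
  using disk edge_edge unfolding disk_def by (metis imageI)

lemma rot_boundary: "p \<in> set bs \<Longrightarrow> rot D p \<in> outside"
  using boundary_inside rot_inside inside_darts rot_in by blast

lemma rot_rot_boundary: "p \<in> set bs \<Longrightarrow> rot D (rot D p) = p"
  using boundary_inside boundary_noncrossing inside_darts by (auto intro: rot_noncrossing)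

lemma resolve_boundary: "p \<in> set bs \<Longrightarrow> resolve D X p = rot D p"
  using boundary_noncrossing by (simp add: resolve_noncrossing)

text \<open>A rotation that leaves the disk starts at a marked point of the boundary; a crossing therefore lies on
  one side.\<close>

lemma crossing_rot_inside: "d \<in> crossing_darts D \<Longrightarrow> rot D d \<in> I \<longleftrightarrow> d \<in> I"
proof -
  have inside: "rot D x \<in> I \<and> rot D x \<in> crossing_darts D"
    if "x \<in> I" "x \<in> crossing_darts D" for x
    using that rot_inside boundary_noncrossing by auto
  assume d: "d \<in> crossing_darts D"
  show "rot D d \<in> I \<longleftrightarrow> d \<in> I"
    using inside[of d] inside[of "rot D d"] inside[of "rot D (rot D d)"]
      inside[of "rot D (rot D (rot D d))"] rot_crossing[OF d] d by auto
qed

lemma crossing_inv_rot_inside: "d \<in> crossing_darts D \<Longrightarrow> inv (rot D) d \<in> I \<longleftrightarrow> d \<in> I"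
  using crossing_rot_inside[of "inv (rot D) d"] by simp

lemma rot_outside: "d \<in> outside \<Longrightarrow> rot D d \<in> I \<longleftrightarrow> d \<in> rot D ` set bs"
proof
  assume d: "d \<in> outside" and "rot D d \<in> I"
  moreover from this have "d \<notin> crossing_darts D" using crossing_rot_inside by auto
  ultimately have "rot D d \<in> set bs" "d = rot D (rot D d)"
    using rot_noncrossing rot_inside[of "rot D d"] by auto
  then show "d \<in> rot D ` set bs" by blast
next
  assume "d \<in> rot D ` set bs"
  then show "rot D d \<in> I" using rot_rot_boundary boundary_inside by auto
qed

lemma resolve_inside: "d \<in> I \<Longrightarrow> d \<notin> set bs \<Longrightarrow> resolve D X d \<in> I"
  using rot_inside crossing_inv_rot_inside by (auto simp: resolve_def)

lemma resolve_outside: "d \<in> outside \<Longrightarrow> resolve D X d \<in> I \<Longrightarrow> resolve D X d \<in> set bs"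
  using resolve_inside resolve_resolve by (metis DiffD1 DiffD2)

lemma curves_closed:
  assumes "(x, y) \<in> curves D t S" "x \<in> T"
    "\<And>z. z \<in> T \<Longrightarrow> z \<in> S \<Longrightarrow> edge D z \<in> S \<Longrightarrow> edge D z \<in> T"
    "\<And>z. z \<in> T \<Longrightarrow> z \<in> S \<Longrightarrow> t z \<in> S \<Longrightarrow> t z \<in> T"
  shows "y \<in> T"
  using assms(1) unfolding curves_def by induction (use assms in auto)

lemma curves_trans: "(x, y) \<in> curves D t S \<Longrightarrow> (y, z) \<in> curves D t S \<Longrightarrow> (x, z) \<in> curves D t S"
  unfolding curves_def by (rule rtrancl_trans)

lemma curves_refl [simp]: "(x, x) \<in> curves D t S"
  by (simp add: curves_def)

lemma curves_edge: "x \<in> S \<Longrightarrow> edge D x \<in> S \<Longrightarrow> (x, edge D x) \<in> curves D t S"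
  unfolding curves_def by blast

lemma curves_turn: "x \<in> S \<Longrightarrow> t x \<in> S \<Longrightarrow> (x, t x) \<in> curves D t S"
  unfolding curves_def by blast

lemma curves_mono: "S \<subseteq> T \<Longrightarrow> curves D t S \<subseteq> curves D t T"
  unfolding curves_def by (rule rtrancl_mono) auto

lemma equiv_curves:
  assumes "S \<subseteq> darts D"
  shows "equiv UNIV (curves D (resolve D X) S)"
proof -
  have "sym {(d, d'). d \<in> S \<and> d' \<in> S \<and> (d' = edge D d \<or> d' = resolve D X d)}"
    using assms edge_edge resolve_resolve by (auto simp: sym_def)
  then show ?thesis
    unfolding equiv_UNIV_iff curves_def by (simp add: sym_rtrancl refl_rtrancl trans_rtrancl)
qed

lemma crossings_times_4: "4 * crossing_number D = card (crossing_darts D)"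
  unfolding crossing_number_def
proof (rule card_orbits)
  show "finite (crossing_darts D)" using finite_darts by (simp add: crossing_darts_def)
  show "bij_betw (rot D) (crossing_darts D) (crossing_darts D)"
    by (rule bij_betw_byWitness[where f' = "inv (rot D)"]) auto
qed (auto simp: crossing_darts_def)

section \<open>Cutting the state circles along the boundary of the disk\<close>

text \<open>An equivalence \<open>E\<close> on exterior darts that sees every connection through the disk: it contains the
  exterior curves and joins the exterior ends of every pair matched inside.\<close>

definition glued :: "resolution \<Rightarrow> ('d \<times> 'd) set \<Rightarrow> bool" where
  "glued X E \<longleftrightarrow> equiv UNIV E \<and> curves D (resolve D X) outside \<subseteq> E \<and>
     (\<forall>p\<in>set bs. \<forall>q\<in>set bs. (p, q) \<in> curves D (resolve D X) I \<longrightarrow> (rot D p, rot D q) \<in> E)"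

text \<open>Following a state circle from an exterior dart, \<open>E\<close> records the exterior part of the path, and
  during an excursion into the disk the boundary point \<open>p\<close> of entry is remembered.\<close>

lemma curves_in_glued:
  assumes E: "glued X E" and "x \<in> outside" and "(x, y) \<in> curves D (resolve D X) (darts D)"
  shows "if y \<in> I then \<exists>p\<in>set bs. (p, y) \<in> curves D (resolve D X) I \<and> (x, rot D p) \<in> E
    else (x, y) \<in> E"
  using assms(3) unfolding curves_def[of D _ "darts D"]
proof induction
  case base
  then show ?case using assms by (auto simp: glued_def equiv_UNIV_iff refl_on_def)
next
  case (step y z)
  let ?t = "resolve D X"
  have y: "y \<in> darts D" and z: "z \<in> darts D" and yz: "z = edge D y \<or> z = ?t y"
    using step.hyps by auto
  have trans: "(a, c) \<in> E" if "(a, b) \<in> E" "(b, c) \<in> E" for a b c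
    using that E by (auto simp: glued_def equiv_UNIV_iff dest: transD)
  consider "y \<in> I" "z \<in> I" | "y \<in> I" "z \<notin> I" | "y \<notin> I" "z \<in> I" | "y \<notin> I" "z \<notin> I"
    by blast
  then show ?case
  proof cases
    case 1
    then have "(y, z) \<in> curves D ?t I" using yz by (auto intro: curves_edge curves_turn)
    then show ?thesis using 1 step.IH by (auto intro: curves_trans)
  next
    case 2
    then have yb: "y \<in> set bs" "z = rot D y"
      using yz y edge_inside resolve_inside resolve_boundary by metis+
    obtain p where "p \<in> set bs" "(p, y) \<in> curves D ?t I" "(x, rot D p) \<in> E"
      using 2 step.IH by auto
    moreover from this have "(rot D p, rot D y) \<in> E" using E yb by (auto simp: glued_def)
    ultimately have "(x, rot D y) \<in> E" using trans by blast
    then show ?thesis using 2 yb by simp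
  next
    case 3
    then have z: "z = ?t y" "z \<in> set bs"
      using yz y edge_inside resolve_outside by blast+
    then have "rot D z = y" using resolve_resolve[OF y] resolve_boundary by metis
    then show ?thesis using 3 step.IH z by (auto intro!: bexI[of _ z])
  next
    case 4
    then have "(y, z) \<in> curves D ?t outside" using yz y z by (auto intro: curves_edge curves_turn)
    then have "(y, z) \<in> E" using E by (auto simp: glued_def)
    then show ?thesis using 4 step.IH trans by auto
  qed
qed

lemma card_quotient_cong:
  assumes "equiv UNIV R" "equiv UNIV E" and eq: "\<And>x y. x \<in> S \<Longrightarrow> y \<in> S \<Longrightarrow> (x, y) \<in> R \<longleftrightarrow> (x, y) \<in> E"
  shows "card (S // R) = card (S // E)"
proof -
  have trace: "card ((\<lambda>K. K \<inter> S) ` (S // Q)) = card (S // Q)" if Q: "equiv UNIV Q" for Q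
  proof (rule card_image, rule inj_onI)
    fix K K' assume K: "K \<in> S // Q" "K' \<in> S // Q" "K \<inter> S = K' \<inter> S"
    then obtain x y where xy: "x \<in> S" "y \<in> S" "K = Q `` {x}" "K' = Q `` {y}" by (auto simp: quotient_def)
    then have "x \<in> K \<inter> S" using Q by (simp add: equiv_UNIV_iff refl_on_def)
    then have "(y, x) \<in> Q" using K xy by auto
    then show "K = K'" using Q xy by (simp add: equiv_class_eq_iff)
  qed
  have "(\<lambda>K. K \<inter> S) ` (S // R) = (\<lambda>K. K \<inter> S) ` (S // E)"
    using eq by (simp add: quotient_def image_UN Int_def cong: conj_cong) blast
  then show ?thesis using trace[OF assms(1)] trace[OF assms(2)] by metis
qed

text \<open>A state circle that meets the exterior is determined by its trace there, which is a class of
  \<open>E\<close>; the remaining circles are closed curves inside that meet no boundary point.\<close>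

lemma state_circles_glued:
  assumes E: "glued X E"
    and least: "\<And>x y. (x, y) \<in> E \<Longrightarrow> (x, y) \<in> curves D (resolve D X) (darts D)"
  shows "state_circles D X = card (outside // E) +
    card {K \<in> I // curves D (resolve D X) I. K \<inter> set bs = {}}"
proof -
  let ?t = "resolve D X"
  let ?R = "curves D ?t (darts D)" and ?RI = "curves D ?t I"
  have R: "equiv UNIV ?R" and RI: "equiv UNIV ?RI" using equiv_curves inside_darts by auto
  have R_refl: "(x, x) \<in> ?R" for x by simp
  have IR: "?RI \<subseteq> ?R" using inside_darts by (rule curves_mono)
  have "(x, y) \<in> ?R \<longleftrightarrow> (x, y) \<in> E" if "x \<in> outside" "y \<in> outside" for x y
    using curves_in_glued[OF E that(1), of y] least that by auto
  then have 1: "card (outside // ?R) = card (outside // E)"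
    using R E by (intro card_quotient_cong) (auto simp: glued_def)
  have closed: "?R `` {x} = ?RI `` {x}" "?R `` {x} \<subseteq> I" if x: "x \<in> I" "?RI `` {x} \<inter> set bs = {}" for x
  proof -
    have sub: "?RI `` {x} \<subseteq> I" using curves_closed[of x _ ?t I I] x by auto
    have "y \<in> ?RI `` {x}" if "(x, y) \<in> ?R" for y
      using that
    proof (rule curves_closed)
      fix z assume z: "z \<in> ?RI `` {x}"
      then have zI: "z \<in> I" "z \<in> darts D" "z \<notin> set bs" using sub x inside_darts by auto
      have "(x, z) \<in> ?RI" using z by simp
      then show "edge D z \<in> ?RI `` {x}" "?t z \<in> ?RI `` {x}"
        using curves_edge[of z I ?t] curves_turn[of z I ?t] edge_inside[of z] resolve_inside[of z X] zI
        by (auto intro: curves_trans)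
    qed simp
    then show "?R `` {x} = ?RI `` {x}" using IR by auto
    then show "?R `` {x} \<subseteq> I" using sub by simp
  qed
  have 2: "darts D // ?R = (outside // ?R) \<union> {K \<in> I // ?RI. K \<inter> set bs = {}}" (is "_ = _ \<union> ?Z")
  proof (intro subset_antisym subsetI)
    fix K assume "K \<in> darts D // ?R"
    then obtain x where x: "x \<in> darts D" "K = ?R `` {x}" by (auto simp: quotient_def)
    show "K \<in> (outside // ?R) \<union> ?Z"
    proof (cases "x \<in> I \<and> ?RI `` {x} \<inter> set bs = {}")
      case True
      then have "K = ?RI `` {x}" using x closed by blast
      then show ?thesis using True by (auto simp: quotient_def)
    next
      case False
      have "\<exists>y\<in>outside. (x, y) \<in> ?R"
      proof (cases "x \<in> I")
        case True
        then obtain p where p: "p \<in> set bs" "(x, p) \<in> ?RI" using False by auto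
        then have "(p, ?t p) \<in> ?R"
          using boundary_inside inside_darts by (intro curves_turn resolve_in) auto
        then have "(x, rot D p) \<in> ?R" using p IR resolve_boundary curves_trans by fastforce
        then show ?thesis using rot_boundary p by blast
      qed (use x R_refl in blast)
      then obtain y where "y \<in> outside" "(x, y) \<in> ?R" by blast
      then have "K = ?R `` {y}" using R x by (simp add: equiv_class_eq_iff)
      then show ?thesis using \<open>y \<in> outside\<close> by (auto simp: quotient_def)
    qed
  next
    fix K assume "K \<in> (outside // ?R) \<union> ?Z"
    then show "K \<in> darts D // ?R"
    proof
      assume "K \<in> ?Z"
      then obtain x where x: "x \<in> I" "K = ?RI `` {x}" "K \<inter> set bs = {}" by (auto simp: quotient_def)
      then have "K = ?R `` {x}" using closed by blast
      then show ?thesis using x inside_darts by (auto simp: quotient_def)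
    qed (auto simp: quotient_def)
  qed
  have 3: "(outside // ?R) \<inter> ?Z = {}"
  proof (rule ccontr)
    assume "(outside // ?R) \<inter> ?Z \<noteq> {}"
    then obtain x y where xy: "x \<in> outside" "y \<in> I" "?RI `` {y} \<inter> set bs = {}" "?R `` {x} = ?RI `` {y}"
      by (fastforce simp: quotient_def)
    then have "x \<in> ?RI `` {y}" using R_refl by blast
    then show False using xy closed by blast
  qed
  have "finite (darts D // ?R)" using finite_darts by (rule finite_reach_quotient)
  then show ?thesis
    unfolding state_circles_def 1[symmetric] 2 by (intro card_Un_disjoint 3) auto
qed

text \<open>The list \<open>ps\<close> contains the pairs of boundary points matched inside the disk, each in one of its two
  orders, and \<open>k\<close> counts the closed circles inside.\<close>

definition inside_state :: "resolution \<Rightarrow> ('d \<times> 'd) list \<Rightarrow> nat \<Rightarrow> bool" where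
  "inside_state X ps k \<longleftrightarrow> set ps \<subseteq> set bs \<times> set bs \<and>
     (\<forall>p\<in>set bs. \<forall>q\<in>set bs. (p, q) \<in> curves D (resolve D X) I \<longleftrightarrow>
        p = q \<or> (p, q) \<in> set ps \<or> (q, p) \<in> set ps) \<and>
     card {K \<in> I // curves D (resolve D X) I. K \<inter> set bs = {}} = k"

lemma state_circles_inside:
  assumes st: "inside_state X ps k"
  shows "state_circles D X = card (outside // merges (curves D (resolve D X) outside)
    (map (map_prod (rot D) (rot D)) ps)) + k"
proof -
  let ?t = "resolve D X"
  let ?R = "curves D ?t outside" and ?ps = "map (map_prod (rot D) (rot D)) ps"
  have R: "equiv UNIV ?R" using equiv_curves by auto
  note E = equiv_merges[OF R, of ?ps] and up = merges_upper[OF R, of ?ps]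
  have full: "equiv UNIV (curves D ?t (darts D))" using equiv_curves by auto
  have ps: "(rot D p, rot D q) \<in> merges ?R ?ps" if "(p, q) \<in> set ps" for p q
    using up that by force
  have "glued X (merges ?R ?ps)"
    unfolding glued_def
  proof (intro conjI E ballI impI)
    fix p q assume "p \<in> set bs" "q \<in> set bs" "(p, q) \<in> curves D ?t I"
    then consider "p = q" | "(p, q) \<in> set ps" | "(q, p) \<in> set ps" using st by (auto simp: inside_state_def)
    then show "(rot D p, rot D q) \<in> merges ?R ?ps"
      using E ps by cases (auto simp: equiv_UNIV_iff refl_on_def dest: symD)
  qed (use up in auto)
  moreover have "merges ?R ?ps \<subseteq> curves D ?t (darts D)"
  proof (rule merges_least[OF full])
    show "?R \<subseteq> curves D ?t (darts D)" by (rule curves_mono) auto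
    show "set ?ps \<subseteq> curves D ?t (darts D)"
    proof (clarsimp)
      fix p q assume "(p, q) \<in> set ps"
      then have pq: "p \<in> set bs" "q \<in> set bs" "(p, q) \<in> curves D ?t I" using st by (auto simp: inside_state_def)
      have turn: "(b, rot D b) \<in> curves D ?t (darts D)" if "b \<in> set bs" for b
        using curves_turn[of b "darts D" ?t] resolve_boundary[OF that] that boundary_inside inside_darts rot_in
        by auto
      have "(p, q) \<in> curves D ?t (darts D)" using pq curves_mono[OF inside_darts] by blast
      then show "(rot D p, rot D q) \<in> curves D ?t (darts D)"
        using turn[OF pq(1)] turn[OF pq(2)] full by (meson curves_trans equiv_UNIV_iff symD)
    qed
  qed
  ultimately show ?thesis
    using state_circles_glued[of X "merges ?R ?ps"] st by (auto simp: inside_state_def)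
qed

text \<open>A tangle is described by the list \<open>Bs\<close> of its arcs and circles, each given by the darts that it
  passes, in order.  Consecutive darts are linked, and closure under both kinds of steps shows that an
  arc is a whole class.\<close>

lemma inside_stateI:
  assumes Bs: "set (concat Bs) = I" "distinct (concat Bs)" "[] \<notin> set Bs"
    and chain: "\<forall>B\<in>set Bs. successively (\<lambda>x y. y = edge D x \<or> y = resolve D X x) B"
    and closed: "\<forall>B\<in>set Bs. \<forall>x\<in>set B. edge D x \<in> set B \<and> (x \<in> set bs \<or> resolve D X x \<in> set B)"
    and ps: "set ps \<subseteq> set bs \<times> set bs"
      "\<forall>p\<in>set bs. \<forall>q\<in>set bs. (\<exists>B\<in>set Bs. p \<in> set B \<and> q \<in> set B) \<longleftrightarrow> p = q \<or> (p, q) \<in> set ps \<or> (q, p) \<in> set ps"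
    and k: "length (filter (\<lambda>B. set B \<inter> set bs = {}) Bs) = k"
  shows "inside_state X ps k"
proof -
  let ?t = "resolve D X"
  let ?R = "curves D ?t I"
  have R: "equiv UNIV ?R" using equiv_curves inside_darts by auto
  have reach_all: "(hd B, x) \<in> ?R"
    if "successively (\<lambda>x y. y = edge D x \<or> y = ?t x) B" "set B \<subseteq> I" "x \<in> set B" for B x
    using that
  proof (induction B rule: induct_list012)
    case (3 a b B)
    have "(a, b) \<in> ?R" using 3 by (auto intro: curves_edge curves_turn)
    then show ?case using 3 by (auto intro: curves_trans)
  qed auto
  have cls: "?R `` {x} = set B" if B: "B \<in> set Bs" "x \<in> set B" for B x
  proof (intro subset_antisym subsetI)
    fix y assume "y \<in> ?R `` {x}"
    then have "(x, y) \<in> ?R" by simp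
    then show "y \<in> set B"
    proof (rule curves_closed)
      fix z assume z: "z \<in> set B" "z \<in> I"
      then show "edge D z \<in> set B" using closed B by blast
      assume "?t z \<in> I"
      then have "z \<notin> set bs" using rot_boundary resolve_boundary by auto
      then show "?t z \<in> set B" using closed B z by blast
    qed (rule B)
  next
    fix y assume "y \<in> set B"
    have BI: "set B \<subseteq> I" using Bs B by auto
    have "(hd B, x) \<in> ?R" "(hd B, y) \<in> ?R"
      using reach_all[OF _ BI] chain B \<open>y \<in> set B\<close> by auto
    then show "y \<in> ?R `` {x}" using R by (meson Image_singleton_iff curves_trans equiv_UNIV_iff symD)
  qed
  have in_I: "\<exists>B\<in>set Bs. x \<in> set B" if "x \<in> I" for x using that Bs by auto
  have "I // ?R = set ` set Bs"
  proof (intro subset_antisym subsetI)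
    fix K assume "K \<in> I // ?R"
    then show "K \<in> set ` set Bs" using cls in_I by (fastforce simp: quotient_def)
  next
    fix K assume "K \<in> set ` set Bs"
    then obtain B where B: "B \<in> set Bs" "K = set B" by auto
    then have "hd B \<in> set B" "hd B \<in> I" using Bs by (metis hd_in_set) (metis B(1) Bs(1,3) UN_I hd_in_set set_concat)
    then show "K \<in> I // ?R" using cls B by (auto simp: quotient_def)
  qed
  then have "{K \<in> I // ?R. K \<inter> set bs = {}} = set ` set (filter (\<lambda>B. set B \<inter> set bs = {}) Bs)"
    by auto
  moreover have "inj_on set (set Bs)"
  proof (rule inj_onI, rule ccontr)
    fix B B' assume B: "B \<in> set Bs" "B' \<in> set Bs" "set B = set B'" "B \<noteq> B'"
    then have "set B \<inter> set B' = {}" using Bs(2) by (meson distinct_concat_iff)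
    then have "B = []" using B by simp
    then show False using B Bs by blast
  qed
  then have "card (set ` set (filter (\<lambda>B. set B \<inter> set bs = {}) Bs)) =
      card (set (filter (\<lambda>B. set B \<inter> set bs = {}) Bs))"
    by (intro card_image) (auto intro: inj_on_subset)
  moreover have "distinct Bs" using Bs by (simp add: distinct_concat_iff)
  ultimately have "card {K \<in> I // ?R. K \<inter> set bs = {}} = k"
    using k distinct_card[OF distinct_filter] by metis
  moreover have "(p, q) \<in> ?R \<longleftrightarrow> (\<exists>B\<in>set Bs. p \<in> set B \<and> q \<in> set B)" if p: "p \<in> set bs" for p q
  proof -
    obtain B where B: "B \<in> set Bs" "p \<in> set B" using p boundary_inside in_I by blast
    then have "(p, q) \<in> ?R \<longleftrightarrow> q \<in> set B" using cls by blast
    also have "\<dots> \<longleftrightarrow> (\<exists>B\<in>set Bs. p \<in> set B \<and> q \<in> set B)"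
      using B cls by blast
    finally show ?thesis .
  qed
  ultimately show ?thesis using ps unfolding inside_state_def by auto
qed

lemma joins_outside_sym: "joins_outside D (resolve D X) I p q \<Longrightarrow> joins_outside D (resolve D X) I q p"
  using equiv_curves[of outside X] by (auto simp: joins_outside_def equiv_UNIV_iff dest: symD)

lemma joins_inside_iff:
  assumes "inside_state X ps k" "p \<in> set bs" "q \<in> set bs"
  shows "joins_inside D (resolve D X) I p q \<longleftrightarrow> p = q \<or> (p, q) \<in> set ps \<or> (q, p) \<in> set ps"
  using assms by (simp add: inside_state_def joins_inside_def)

lemma inside_matching_eq:
  assumes "inside_state X ps k"
  shows "inside_matching D (resolve D X) I bs = {(p, q). p \<noteq> q \<and> ((p, q) \<in> set ps \<or> (q, p) \<in> set ps)}"
  using assms joins_inside_iff[OF assms] by (auto simp: inside_matching_def inside_state_def)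

lemma inside_state_cong:
  assumes "inside_state X ps k"
    and "\<And>p q. (p, q) \<in> set ps \<or> (q, p) \<in> set ps \<longleftrightarrow> (p, q) \<in> set ps' \<or> (q, p) \<in> set ps'"
  shows "inside_state X ps' k"
proof -
  have "set ps' \<subseteq> set bs \<times> set bs"
  proof (rule subrelI)
    fix p q assume "(p, q) \<in> set ps'"
    then have "(p, q) \<in> set ps \<or> (q, p) \<in> set ps" using assms(2) by blast
    then show "(p, q) \<in> set bs \<times> set bs" using assms(1) by (auto simp: inside_state_def)
  qed
  then show ?thesis using assms unfolding inside_state_def by simp
qed

section \<open>Exterior arcs join boundary points of opposite parity\<close>

lemma sum_if_flip:
  fixes s :: "'a \<Rightarrow> int"
  assumes "finite S" and f: "\<And>x. x \<in> S \<Longrightarrow> f x \<in> S \<and> f (f x) = x \<and> s (f x) = - s x"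
  shows "sum s S = 0"
proof -
  have "bij_betw f S S" by (rule bij_betw_byWitness[where f' = f]) (use f in auto)
  then have "sum s S = (\<Sum>x\<in>S. s (f x))" by (rule sum.reindex_bij_betw[symmetric])
  also have "\<dots> = - sum s S" using f by (simp add: sum_negf)
  finally show ?thesis by simp
qed

lemma cap_outside:
  assumes "x \<in> outside"
  shows "cap (map (rot D) bs) (rot D) x \<in> outside"
    and "x \<in> rot D ` set bs \<longleftrightarrow> cap (map (rot D) bs) (rot D) x \<in> rot D ` set bs"
proof -
  have cyc: "cycle_of_list (map (rot D) bs) x \<in> rot D ` set bs \<longleftrightarrow> x \<in> rot D ` set bs"
    using permutes_in_image[OF cycle_permutes, of "map (rot D) bs"] by simp
  have "rot D x \<notin> rot D ` set bs" using assms boundary_inside rot_inj by auto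
  then show "x \<in> rot D ` set bs \<longleftrightarrow> cap (map (rot D) bs) (rot D) x \<in> rot D ` set bs"
    using cyc by (auto simp: cap_def)
  show "cap (map (rot D) bs) (rot D) x \<in> outside"
    using cyc rot_boundary rot_outside[OF assms] assms rot_in by (auto simp: cap_def)
qed

text \<open>The vertices of the exterior with the disk collapsed are the old ones, of degree 2 or 4, and the
  new one, whose degree is the number of boundary points.\<close>

lemma cap_even_degree:
  assumes "even (length bs)" "x \<in> outside" "(cap (map (rot D) bs) (rot D) ^^ n) x = x"
  shows "even n"
proof (cases "x \<in> rot D ` set bs")
  case True
  let ?cs = "map (rot D) bs"
  have dist: "distinct ?cs" using distinct_boundary rot_inj by (simp add: distinct_map inj_on_def)
  have "(cap ?cs (rot D) ^^ n) x = (cycle_of_list ?cs ^^ n) x \<and> (cycle_of_list ?cs ^^ n) x \<in> set ?cs"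
  proof (induction n)
    case (Suc n)
    then show ?case using permutes_in_image[OF cycle_permutes, of ?cs] by (auto simp: cap_def)
  qed (use True in auto)
  then have fix_x: "(cycle_of_list ?cs ^^ n) x = x" using assms by simp
  obtain i where i: "i < length ?cs" "x = ?cs ! i" using True by (auto simp: in_set_conv_nth)
  have "(cycle_of_list ?cs ^^ n) (?cs ! i) = rotate n ?cs ! i"
    using cyclic_rotation[OF dist, of n] i by (metis nth_map)
  then have "?cs ! ((n + i) mod length ?cs) = ?cs ! i"
    using fix_x i by (simp add: nth_rotate)
  then have "(n + i) mod length ?cs = i"
    using dist i by (subst (asm) nth_eq_iff_index_eq) (auto intro: mod_less_divisor)
  then have "(n + i) mod length ?cs = i mod length ?cs" using i by simp
  then have "length ?cs dvd n" by (metis add_diff_cancel_right' le_add2 mod_eq_dvd_iff_nat)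
  then show ?thesis using assms(1) by auto
next
  case False
  have "(cap (map (rot D) bs) (rot D) ^^ n) x = (rot D ^^ n) x \<and>
    (rot D ^^ n) x \<in> outside \<and> (rot D ^^ n) x \<notin> rot D ` set bs"
  proof (induction n)
    case (Suc n)
    then show ?case using cap_outside[of "(rot D ^^ n) x"] by (auto simp: cap_def)
  qed (use False assms in auto)
  then have "card (orbit (rot D) x) dvd n" using assms rot_period(2) by metis
  then show ?thesis using card_orbit_rot[of x] assms by auto
qed

lemma bij_cap: "bij_betw (cap (map (rot D) bs) (rot D)) outside outside"
proof -
  let ?r = "cap (map (rot D) bs) (rot D)"
  have "inj_on ?r outside"
  proof (rule inj_onI)
    fix x y assume xy: "x \<in> outside" "y \<in> outside" "?r x = ?r y"
    then have "x \<in> rot D ` set bs \<longleftrightarrow> y \<in> rot D ` set bs" using cap_outside by metis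
    then show "x = y"
      using xy(3) permutes_inj[OF cycle_permutes[of "map (rot D) bs"]] rot_inj
      by (auto simp: cap_def inj_eq split: if_splits)
  qed
  moreover have "?r ` outside \<subseteq> outside" using cap_outside by blast
  ultimately show ?thesis
    using finite_darts by (simp add: bij_betw_def endo_inj_surj)
qed

text \<open>In a class of exterior curves the edge involution pairs the darts of the two colours, and so
  does the resolution on the darts that are not at the boundary.  Hence the boundary darts of the
  class are balanced as well, and at the collapsed disk their colours alternate.\<close>

theorem balanced_classes:
  assumes "even (length bs)"
  shows "(\<Sum>i<length bs. if (x, rot D (bs ! i)) \<in> curves D (resolve D X) outside
    then (-1) ^ i else 0 :: int) = 0"
proof (cases "x \<in> outside")
  case False
  have "y \<in> {x}" if "(x, y) \<in> curves D (resolve D X) outside" for y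
    using that by (rule curves_closed) (use False in auto)
  then have "(x, rot D (bs ! i)) \<notin> curves D (resolve D X) outside" if "i < length bs" for i
    using rot_boundary[of "bs ! i"] that False by auto
  then show ?thesis by (intro sum.neutral) auto
next
  case x: True
  let ?cs = "map (rot D) bs" and ?t = "resolve D X"
  let ?r = "cap ?cs (rot D)" and ?S = "curves D ?t outside `` {x}"
  have cs: "set ?cs = rot D ` set bs" by simp
  have edge_out: "edge D y \<in> outside" if "y \<in> outside" for y
    using that edge_in edge_inside by auto
  obtain c :: "'d \<Rightarrow> bool" where c: "\<And>y. y \<in> outside \<Longrightarrow> c (edge D y) \<noteq> c y \<and> c (?r y) \<noteq> c y"
  proof (rule checkerboard_colouring[of outside ?r "edge D"])
    show "planar_map outside (edge D) ?r" using disk by (simp add: disk_def)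
    fix c :: "'d \<Rightarrow> bool" assume "\<And>y. y \<in> outside \<Longrightarrow> c (edge D y) \<noteq> c y \<and> c (?r y) \<noteq> c y"
    then show thesis by (rule that)
  next
    fix y n assume "y \<in> outside" "(?r ^^ n) y = y"
    then show "even n" by (rule cap_even_degree[OF assms])
  next
    fix y assume "y \<in> outside"
    then show "edge D y \<noteq> y \<and> edge D (edge D y) = y" using edge_neq edge_edge by simp
  next
    show "finite outside" using finite_darts by simp
  next
    show "bij_betw ?r outside outside" by (rule bij_cap)
  next
    fix y assume "y \<in> outside"
    then show "edge D y \<in> outside" by (rule edge_out)
  qed
  \<comment> \<open>the sign of a colour; all sums of signs over sets paired by a colour-changing involution vanish\<close>
  define s where "s y = (if c y then 1 else -1 :: int)" for y
  have S: "?S \<subseteq> outside"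
  proof
    fix y assume "y \<in> ?S"
    then have "(x, y) \<in> curves D ?t outside" by simp
    then show "y \<in> outside" by (rule curves_closed[OF _ x])
  qed
  then have fin: "finite ?S" using finite_darts by (meson finite_Diff finite_subset)
  have S_edge: "edge D y \<in> ?S" if "y \<in> ?S" for y
  proof -
    have "y \<in> outside" "(x, y) \<in> curves D ?t outside" using that S by auto
    then have "(x, edge D y) \<in> curves D ?t outside"
      using curves_edge[of y outside ?t] edge_out curves_trans by blast
    then show ?thesis by simp
  qed
  have turn: "?t y \<in> outside \<and> ?t y \<notin> set ?cs \<and> c (?t y) \<noteq> c y"
    if y: "y \<in> outside" "y \<notin> set ?cs" for y
  proof -
    have ty: "?t y \<in> outside"
    proof -
      have "?t y \<notin> I"
      proof
        assume "?t y \<in> I"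
        then have b: "?t y \<in> set bs" using resolve_outside y by blast
        then have "y = rot D (?t y)" using resolve_resolve[of y X] resolve_boundary[OF b, of X] y by auto
        then show False using b y by auto
      qed
      then show ?thesis using resolve_in y by blast
    qed
    have "?t y \<notin> set ?cs"
    proof
      assume "?t y \<in> set ?cs"
      then obtain p where p: "p \<in> set bs" "?t y = rot D p" by auto
      then have "?t (rot D p) = p"
        using rot_rot_boundary boundary_noncrossing by (simp add: resolve_noncrossing)
      then have "y = p" using p resolve_resolve y by (metis DiffD1)
      then show False using p y boundary_inside by blast
    qed
    moreover have "?r y = ?t y \<or> ?r (?t y) = y"
      using y \<open>?t y \<notin> set ?cs\<close> by (auto simp: cap_def resolve_def)
    ultimately show ?thesis using c y ty by metis
  qed
  have "sum s ?S = 0"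
    by (rule sum_if_flip[OF fin, of "edge D"]) (use S S_edge c edge_edge in \<open>auto simp: s_def\<close>)
  moreover have "sum s (?S - set ?cs) = 0"
  proof (rule sum_if_flip)
    fix y assume y: "y \<in> ?S - set ?cs"
    then have yo: "y \<in> outside" "y \<notin> set ?cs" using S by auto
    note t = turn[OF yo]
    have "(y, ?t y) \<in> curves D ?t outside" using yo t by (intro curves_turn) auto
    then have "?t y \<in> ?S" using y by (auto intro: curves_trans)
    then show "?t y \<in> ?S - set ?cs \<and> ?t (?t y) = y \<and> s (?t y) = - s y"
      using t yo resolve_resolve by (auto simp: s_def)
  qed (use fin in auto)
  moreover have "sum s ?S = sum s (?S - set ?cs) + sum s (?S \<inter> set ?cs)"
    using sum.Int_Diff[OF fin, of s "set ?cs"] by simp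
  ultimately have "0 = sum s (set ?cs \<inter> ?S)" by (simp add: Int_commute)
  also have "\<dots> = (\<Sum>y\<in>set ?cs. if y \<in> ?S then s y else 0)" by (rule sum.inter_restrict) simp
  also have "\<dots> = (\<Sum>i<length ?cs. if ?cs ! i \<in> ?S then s (?cs ! i) else 0)"
    using distinct_boundary rot_inj
    by (intro sum.reindex_bij_betw[symmetric] bij_betw_nth) (auto simp: distinct_map inj_on_def)
  also have "\<dots> = (\<Sum>i<length bs. s (?cs ! 0) *
      (if (x, rot D (bs ! i)) \<in> curves D ?t outside then (-1) ^ i else 0))"
  proof (rule sum.cong)
    fix i assume "i \<in> {..<length bs}"
    then have i: "i < length ?cs" by simp
    have dist: "distinct ?cs" using distinct_boundary rot_inj by (simp add: distinct_map inj_on_def)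
    have "s (?cs ! i) = s (?cs ! 0) * (-1) ^ i"
      using i
    proof (induction i)
      case (Suc i)
      then have "cycle_of_list ?cs (?cs ! i) = ?cs ! Suc i"
        using cyclic_rotation[OF dist, of 1] nth_map[of i ?cs "cycle_of_list ?cs"] nth_rotate1[of i ?cs] by simp
      moreover have "?cs ! i \<in> set ?cs" using Suc.prems by (intro nth_mem) simp
      ultimately have "?r (?cs ! i) = ?cs ! Suc i" "?cs ! i \<in> outside"
        using rot_boundary by (auto simp: cap_def)
      then have "s (?cs ! Suc i) = - s (?cs ! i)" using c[of "?cs ! i"] by (auto simp: s_def)
      then show ?case using Suc by simp
    qed simp
    then show "(if ?cs ! i \<in> ?S then s (?cs ! i) else 0) =
        s (?cs ! 0) * (if (x, rot D (bs ! i)) \<in> curves D ?t outside then (-1) ^ i else 0)"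
      using i by simp
  qed simp
  finally show ?thesis
    by (simp add: sum_distrib_left[symmetric] s_def split: if_splits)
qed

lemma balanced_points:
  assumes "even (length bs)"
  shows "(\<Sum>i<length bs. if (x, map (rot D) bs ! i) \<in> curves D (resolve D X) outside
    then (-1) ^ i else 0 :: int) = 0"
  by (subst balanced_classes[OF assms, of x X, symmetric], rule sum.cong) auto

end

section \<open>The states of the local tangles\<close>

text \<open>The inner matching of a Type III tangle, where \<open>u\<close>, \<open>v\<close>, \<open>w\<close> tell whether the resolution separates
  the crossing of that name into an arc at the boundary and an arc along the central triangle.  If this
  happens twice, all three matched pairs are neighbours.  If it happens once, the two points at that
  crossing and the two points facing them across the triangle are matched, and the remaining two
  points are joined through the triangle.\<close>

definition triangle_matching :: "'a \<Rightarrow> 'a \<Rightarrow> 'a \<Rightarrow> 'a \<Rightarrow> 'a \<Rightarrow> 'a \<Rightarrow> bool \<Rightarrow> bool \<Rightarrow> bool \<Rightarrow> ('a \<times> 'a) list" where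
  "triangle_matching p0 p1 p2 p3 p4 p5 u v w =
     (if u \<and> v \<or> v \<and> w \<or> w \<and> u then [(p0, p1), (p2, p3), (p4, p5)]
      else if u then [(p0, p1), (p2, p5), (p3, p4)]
      else if w then [(p2, p3), (p4, p1), (p5, p0)]
      else [(p4, p5), (p0, p3), (p1, p2)])"

lemma triangle_matching_two:
  "u \<and> v \<or> v \<and> w \<or> w \<and> u \<Longrightarrow>
    triangle_matching p0 p1 p2 p3 p4 p5 u v w = [(p0, p1), (p2, p3), (p4, p5)]"
  by (simp add: triangle_matching_def)

text \<open>Moving a strand across the triangle cyclically shifts the boundary points and the crossings; if a
  single crossing is separated, the pairs stay the same.\<close>

lemma triangle_matching_rotate:
  assumes "\<not> (u \<and> v \<or> v \<and> w \<or> w \<and> u)" "u \<or> v \<or> w"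
  shows "(p, q) \<in> set (triangle_matching p1 p2 p3 p4 p5 p0 v w u) \<or>
      (q, p) \<in> set (triangle_matching p1 p2 p3 p4 p5 p0 v w u) \<longleftrightarrow>
    (p, q) \<in> set (triangle_matching p0 p1 p2 p3 p4 p5 u v w) \<or>
      (q, p) \<in> set (triangle_matching p0 p1 p2 p3 p4 p5 u v w)"
  using assms by (cases u; cases v; cases w) (auto simp: triangle_matching_def)

context disk_in_diagram
begin

text \<open>Over-darts and under-darts alternate around a crossing and the resolution treats opposite darts
  alike, so comparing the type of \<open>x0\<close> with \<open>X\<close> decides between the two smoothings.\<close>

lemma crossing_atD:
  assumes x: "crossing_at D h [x0, x1, x2, x3]" "{x0, x1, x2, x3} \<subseteq> darts D"
  shows "{x0, x1, x2, x3} \<subseteq> crossing_darts D"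
    and "h = (X = Res_B) \<Longrightarrow> resolve D X x0 = x1 \<and> resolve D X x1 = x0 \<and> resolve D X x2 = x3 \<and> resolve D X x3 = x2"
    and "h \<noteq> (X = Res_B) \<Longrightarrow> resolve D X x0 = x3 \<and> resolve D X x1 = x2 \<and> resolve D X x2 = x1 \<and> resolve D X x3 = x0"
proof -
  have step: "rot D ([x0, x1, x2, x3] ! i) = [x0, x1, x2, x3] ! ((i + 1) mod 4)" if "i < 4" for i
    using x(1) that unfolding crossing_at_def by blast
  have r: "rot D x0 = x1" "rot D x1 = x2" "rot D x2 = x3" "rot D x3 = x0"
    using step[of 0] step[of 1] step[of 2] step[of 3] by simp_all
  have "distinct [x0, x1, x2, x3]" and h: "x0 \<in> over D \<longleftrightarrow> h"
    using x(1) unfolding crossing_at_def by auto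
  then have c0: "x0 \<in> crossing_darts D" using rot_noncrossing[of x0] x(2) by (auto simp: r)
  then have c: "x1 \<in> crossing_darts D" "x2 \<in> crossing_darts D" "x3 \<in> crossing_darts D"
    using crossing_rot[of x0] crossing_rot[of x1] crossing_rot[of x2] by (simp_all add: r)
  then show "{x0, x1, x2, x3} \<subseteq> crossing_darts D" using c0 by simp
  have ov: "x1 \<in> over D \<longleftrightarrow> \<not> h" "x2 \<in> over D \<longleftrightarrow> h" "x3 \<in> over D \<longleftrightarrow> \<not> h"
    using over_rot[OF c0] over_rot[OF c(1)] over_rot[OF c(2)] h by (simp_all add: r)
  have i: "inv (rot D) x0 = x3" "inv (rot D) x1 = x0" "inv (rot D) x2 = x1" "inv (rot D) x3 = x2"
    using inv_rot(1)[of x3] inv_rot(1)[of x0] inv_rot(1)[of x1] inv_rot(1)[of x2] by (simp_all add: r)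
  show "h = (X = Res_B) \<Longrightarrow> resolve D X x0 = x1 \<and> resolve D X x1 = x0 \<and> resolve D X x2 = x3 \<and> resolve D X x3 = x2"
    using c0 c by (simp add: resolve_def r i ov h)
  show "h \<noteq> (X = Res_B) \<Longrightarrow> resolve D X x0 = x3 \<and> resolve D X x1 = x2 \<and> resolve D X x2 = x1 \<and> resolve D X x3 = x0"
    using c0 c by (auto simp: resolve_def r i ov h)
qed

lemma crossing_number_inside:
  assumes "I = set (cs @ xs)" "distinct (cs @ xs)" "set cs = set bs" "set xs \<subseteq> crossing_darts D"
  shows "4 * crossing_number D = card (crossing_darts D - I) + length xs"
proof -
  have "crossing_darts D \<inter> I = set xs" using assms boundary_noncrossing by force
  moreover have "finite (crossing_darts D)" using finite_darts by (simp add: crossing_darts_def)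
  ultimately have "card (crossing_darts D) = card (crossing_darts D - I) + card (set xs)"
    using card_Diff_subset_Int[of "crossing_darts D" I] card_mono[of "crossing_darts D" "set xs"]
    by (metis Diff_subset Int_lower1 add.commute finite_Int le_add_diff_inverse2)
  moreover have "card (set xs) = length xs" using assms distinct_card by auto
  ultimately show ?thesis unfolding crossings_times_4 by simp
qed

lemma edge_sym: "edge D p = x \<Longrightarrow> p \<in> I \<Longrightarrow> edge D x = p"
  using edge_edge inside_darts by (metis subsetD)

lemma arc_state:
  assumes "arc_tangle D I bs"
  obtains p q where "bs = [p, q]" "\<And>X. inside_state X [(p, q)] 0"
    "4 * crossing_number D = card (crossing_darts D - I)"
proof -
  obtain p q where t: "bs = [p, q]" "I = {p, q}" "edge D p = q"
    using assms unfolding arc_tangle_def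
    by (elim exE conjE) (rule that, assumption+)
  have pq: "p \<noteq> q" using t distinct_boundary by simp
  have e: "edge D q = p" by (rule edge_sym; use t in simp)
  have "inside_state X [(p, q)] 0" for X
    by (rule inside_stateI[where Bs = "[[p, q]]"]) (use pq in \<open>simp_all add: t e\<close>)
  then show thesis using that t crossing_number_inside[of bs "[]"] distinct_boundary by auto
qed

text \<open>Exactly one of the two resolutions cuts off the loop \<open>x2 x3\<close> as a circle.\<close>

lemma kink_state:
  assumes "kink_tangle D I bs"
  obtains p q h where "bs = [p, q]" "\<And>X. inside_state X [(p, q)] (if h = (X = Res_B) then 1 else 0)"
    "4 * crossing_number D = card (crossing_darts D - I) + 4"
proof -
  obtain p q x0 x1 x2 x3 h where t: "bs = [p, q]" "I = set (bs @ [x0, x1, x2, x3])"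
      "distinct (bs @ [x0, x1, x2, x3])" "crossing_at D h [x0, x1, x2, x3]"
    and e: "edge D p = x0" "edge D q = x1" "edge D x2 = x3"
    using assms unfolding kink_tangle_def
    by (elim exE conjE) (rule that, assumption+)
  have e': "edge D x0 = p" "edge D x1 = q" "edge D x3 = x2"
    by (rule edge_sym, rule e, simp add: t(1,2))+
  note x = crossing_atD[OF t(4)]
  have xd: "{x0, x1, x2, x3} \<subseteq> darts D" using t inside_darts by auto
  have "inside_state X [(p, q)] (if h = (X = Res_B) then 1 else 0)" for X
  proof (cases "h = (X = Res_B)")
    case True
    show ?thesis
      by (rule inside_stateI[where Bs = "[[p, x0, x1, q], [x2, x3]]"])
        (use t(3) t(3)[THEN distinct_rev[THEN iffD2]] True in \<open>simp_all add: t(1,2) e e' x(2)[OF xd True]\<close>, auto?)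
  next
    case False
    show ?thesis
      by (rule inside_stateI[where Bs = "[[p, x0, x3, x2, x1, q]]"])
        (use t(3) t(3)[THEN distinct_rev[THEN iffD2]] False in \<open>simp_all add: t(1,2) e e' x(3)[OF xd False]\<close>, auto?)
  qed
  then show thesis using that t crossing_number_inside[OF t(2,3)] x(1)[OF xd] by auto
qed

lemma parallel_state:
  assumes "parallel_tangle D I bs"
  obtains nw sw se ne where "bs = [nw, sw, se, ne]" "\<And>X. inside_state X [(nw, ne), (sw, se)] 0"
    "4 * crossing_number D = card (crossing_darts D - I)" "I = set bs"
proof -
  obtain nw sw se ne where t: "bs = [nw, sw, se, ne]" "I = set bs" "distinct bs"
    and e: "edge D nw = ne" "edge D sw = se"
    using assms unfolding parallel_tangle_def
    by (elim exE conjE) (rule that, assumption+)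
  have e': "edge D ne = nw" "edge D se = sw"
    by (rule edge_sym, rule e, simp add: t(1,2))+
  have "inside_state X [(nw, ne), (sw, se)] 0" for X
    by (rule inside_stateI[where Bs = "[[nw, ne], [sw, se]]"]) (use t(3) t(3)[THEN distinct_rev[THEN iffD2]] in \<open>simp_all add: t(1,2) e e'\<close>, auto?)
  then show thesis using that t crossing_number_inside[of bs "[]"] by auto
qed

text \<open>Since the crossings \<open>x\<close> and \<open>y\<close> of the bigon have opposite types, each all-\<open>X\<close> state smooths
  one of them horizontally and the other vertically.  In both cases the left ends are joined, the
  right ends are joined, and the bigon is opened without leaving a circle.\<close>

lemma bigon_state:
  assumes "bigon_tangle D I bs"
  obtains nw sw se ne where "bs = [nw, sw, se, ne]" "\<And>X. inside_state X [(nw, sw), (se, ne)] 0"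
    "4 * crossing_number D = card (crossing_darts D - I) + 8"
proof -
  obtain nw sw se ne x0 x1 x2 x3 y0 y1 y2 y3 h where t: "bs = [nw, sw, se, ne]"
      "I = set (bs @ [x0, x1, x2, x3] @ [y0, y1, y2, y3])"
      "distinct (bs @ [x0, x1, x2, x3] @ [y0, y1, y2, y3])"
      "crossing_at D h [x0, x1, x2, x3]" "crossing_at D (\<not> h) [y0, y1, y2, y3]"
    and e: "edge D nw = x1" "edge D sw = x2" "edge D se = y3" "edge D ne = y0"
      "edge D x0 = y1" "edge D x3 = y2"
    using assms unfolding bigon_tangle_def
    by (elim exE conjE) (rule that, assumption+)
  have e': "edge D x1 = nw" "edge D x2 = sw" "edge D y3 = se" "edge D y0 = ne"
      "edge D y1 = x0" "edge D y2 = x3"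
    by (rule edge_sym, rule e, simp add: t(1,2))+
  note x = crossing_atD[OF t(4)] and y = crossing_atD[OF t(5)]
  have xd: "{x0, x1, x2, x3} \<subseteq> darts D" and yd: "{y0, y1, y2, y3} \<subseteq> darts D"
    using t inside_darts by auto
  have "inside_state X [(nw, sw), (se, ne)] 0" for X
  proof (cases "h = (X = Res_B)")
    case True
    then have "(\<not> h) \<noteq> (X = Res_B)" by simp
    note xy = x(2)[OF xd True] y(3)[OF yd this]
    show ?thesis
      by (rule inside_stateI[where Bs = "[[nw, x1, x0, y1, y2, x3, x2, sw], [se, y3, y0, ne]]"])
        (use t(3) t(3)[THEN distinct_rev[THEN iffD2]] in \<open>simp_all add: t(1,2) e e' xy\<close>, auto?)
  next
    case False
    then have "(\<not> h) = (X = Res_B)" by simp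
    note xy = x(3)[OF xd False] y(2)[OF yd this]
    show ?thesis
      by (rule inside_stateI[where Bs = "[[nw, x1, x2, sw], [se, y3, y2, x3, x0, y1, y0, ne]]"])
        (use t(3) t(3)[THEN distinct_rev[THEN iffD2]] in \<open>simp_all add: t(1,2) e e' xy\<close>, auto?)
  qed
  then show thesis
    using that t(1) crossing_number_inside[OF t(2,3)] x(1)[OF xd] y(1)[OF yd] by auto
qed

text \<open>The strands have distinct heights, so the three conditions \<open>h0 > h1\<close>, \<open>h1 > h2\<close>, \<open>h2 > h0\<close> are not
  all equivalent: one crossing is resolved differently from the other two.  This excludes a
  circle around the triangle and leaves the six cases below.\<close>

lemma triangle_state:
  assumes "triangle_tangle D I bs' h0 h1 h2" and bs': "set bs' = set bs" "length bs' = length bs"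
  obtains p0 p1 p2 p3 p4 p5 where "bs' = [p0, p1, p2, p3, p4, p5]"
    "\<And>X. inside_state X (triangle_matching p0 p1 p2 p3 p4 p5
       ((h0 > h1) = (X = Res_B)) ((h1 > h2) = (X = Res_B)) ((h2 > h0) = (X = Res_B))) 0"
    "4 * crossing_number D = card (crossing_darts D - I) + 12"
proof -
  obtain p0 p1 p2 p3 p4 p5 u0 u1 u2 u3 v0 v1 v2 v3 w0 w1 w2 w3 where
    t: "bs' = [p0, p1, p2, p3, p4, p5]"
      "I = set (bs' @ [u0, u1, u2, u3] @ [v0, v1, v2, v3] @ [w0, w1, w2, w3])"
      "distinct (bs' @ [u0, u1, u2, u3] @ [v0, v1, v2, v3] @ [w0, w1, w2, w3])"
      "crossing_at D (h0 > h1) [u0, u1, u2, u3]" "crossing_at D (h2 > h0) [w0, w1, w2, w3]"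
      "crossing_at D (h1 > h2) [v0, v1, v2, v3]"
    and e: "edge D p0 = u0" "edge D p1 = u1" "edge D p2 = w0" "edge D p3 = w1"
      "edge D p4 = v0" "edge D p5 = v1" "edge D u2 = w3" "edge D w2 = v3" "edge D v2 = u3"
    using assms(1) unfolding triangle_tangle_def
    by (elim exE conjE) (rule that, assumption+)
  have heights: "distinct [h0, h1, h2]" using assms(1) by (simp add: triangle_tangle_def)
  have e': "edge D u0 = p0" "edge D u1 = p1" "edge D w0 = p2" "edge D w1 = p3"
      "edge D v0 = p4" "edge D v1 = p5" "edge D w3 = u2" "edge D v3 = w2" "edge D u3 = v2"
    by (rule edge_sym, rule e, simp add: t(1,2))+
  have b: "set bs = {p0, p1, p2, p3, p4, p5}" using bs' t by simp
  have ud: "{u0, u1, u2, u3} \<subseteq> darts D" and vd: "{v0, v1, v2, v3} \<subseteq> darts D"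
    and wd: "{w0, w1, w2, w3} \<subseteq> darts D"
    using t inside_darts by auto
  note U = crossing_atD[OF t(4) ud] and V = crossing_atD[OF t(6) vd] and W = crossing_atD[OF t(5) wd]
  have st: "inside_state X (triangle_matching p0 p1 p2 p3 p4 p5
       ((h0 > h1) = (X = Res_B)) ((h1 > h2) = (X = Res_B)) ((h2 > h0) = (X = Res_B))) 0"
    (is "inside_state X (triangle_matching p0 p1 p2 p3 p4 p5 ?u ?v ?w) 0") for X
  proof -
    consider (u_case) "?u" "\<not> ?v" "\<not> ?w" | (v_case) "\<not> ?u" "?v" "\<not> ?w" | (w_case) "\<not> ?u" "\<not> ?v" "?w"
      | (nu_case) "\<not> ?u" "?v" "?w" | (nv_case) "?u" "\<not> ?v" "?w" | (nw_case) "?u" "?v" "\<not> ?w"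
      using heights by (cases X) auto
    then show ?thesis
    proof cases
      case u_case
      note s = U(2)[OF u_case(1)] V(3)[OF u_case(2)] W(3)[OF u_case(3)]
      show ?thesis
        unfolding triangle_matching_def
        by (rule inside_stateI[where Bs = "[[p0, u0, u1, p1], [p2, w0, w3, u2, u3, v2, v1, p5], [p3, w1, w2, v3, v0, p4]]"])
          (use t(3) t(3)[THEN distinct_rev[THEN iffD2]] u_case in \<open>simp_all add: t(1,2) b e e' s\<close>, auto?)
    next
      case v_case
      note s = U(3)[OF v_case(1)] V(2)[OF v_case(2)] W(3)[OF v_case(3)]
      show ?thesis
        unfolding triangle_matching_def
        by (rule inside_stateI[where Bs = "[[p4, v0, v1, p5], [p0, u0, u3, v2, v3, w2, w1, p3], [p1, u1, u2, w3, w0, p2]]"])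
          (use t(3) t(3)[THEN distinct_rev[THEN iffD2]] v_case in \<open>simp_all add: t(1,2) b e e' s\<close>, auto?)
    next
      case w_case
      note s = U(3)[OF w_case(1)] V(3)[OF w_case(2)] W(2)[OF w_case(3)]
      show ?thesis
        unfolding triangle_matching_def
        by (rule inside_stateI[where Bs = "[[p2, w0, w1, p3], [p4, v0, v3, w2, w3, u2, u1, p1], [p5, v1, v2, u3, u0, p0]]"])
          (use t(3) t(3)[THEN distinct_rev[THEN iffD2]] w_case in \<open>simp_all add: t(1,2) b e e' s\<close>, auto?)
    next
      case nu_case
      note s = U(3)[OF nu_case(1)] V(2)[OF nu_case(2)] W(2)[OF nu_case(3)]
      show ?thesis
        unfolding triangle_matching_def
        by (rule inside_stateI[where Bs = "[[p0, u0, u3, v2, v3, w2, w3, u2, u1, p1], [p2, w0, w1, p3], [p4, v0, v1, p5]]"])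
          (use t(3) t(3)[THEN distinct_rev[THEN iffD2]] nu_case in \<open>simp_all add: t(1,2) b e e' s\<close>, auto?)
    next
      case nv_case
      note s = U(2)[OF nv_case(1)] V(3)[OF nv_case(2)] W(2)[OF nv_case(3)]
      show ?thesis
        unfolding triangle_matching_def
        by (rule inside_stateI[where Bs = "[[p4, v0, v3, w2, w3, u2, u3, v2, v1, p5], [p0, u0, u1, p1], [p2, w0, w1, p3]]"])
          (use t(3) t(3)[THEN distinct_rev[THEN iffD2]] nv_case in \<open>simp_all add: t(1,2) b e e' s\<close>, auto?)
    next
      case nw_case
      note s = U(2)[OF nw_case(1)] V(2)[OF nw_case(2)] W(3)[OF nw_case(3)]
      show ?thesis
        unfolding triangle_matching_def
        by (rule inside_stateI[where Bs = "[[p2, w0, w3, u2, u3, v2, v3, w2, w1, p3], [p0, u0, u1, p1], [p4, v0, v1, p5]]"])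
          (use t(3) t(3)[THEN distinct_rev[THEN iffD2]] nw_case in \<open>simp_all add: t(1,2) b e e' s\<close>, auto?)
    qed
  qed
  have "4 * crossing_number D = card (crossing_darts D - I) +
      length ([u0, u1, u2, u3] @ [v0, v1, v2, v3] @ [w0, w1, w2, w3])"
    by (rule crossing_number_inside[OF t(2,3) bs'(1)]) (use U(1) V(1) W(1) in simp)
  then show thesis using that t(1) st by simp
qed

end

section \<open>Counting circles through few boundary points\<close>

lemma mem_merge: "(x, y) \<in> merge R a b \<longleftrightarrow>
    (x, y) \<in> R \<or> (x, a) \<in> R \<and> (b, y) \<in> R \<or> (x, b) \<in> R \<and> (a, y) \<in> R"
  by (simp add: merge_def)

lemma card_two_merges:
  assumes R: "equiv UNIV R" and "finite H" "{a, b, c, d} \<subseteq> H"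
  shows "card (H // merges R [(a, b), (c, d)]) + (if (a, b) \<in> R then 0 else 1) +
    (if (c, d) \<in> merge R a b then 0 else 1) = card (H // R)"
  using card_merge[OF R, of H a b] card_merge[OF equiv_merge[OF R], of H c d a b] assms
  by simp

lemma card_three_merges:
  assumes R: "equiv UNIV R" and "finite H" "{a, b, c, d, e, f} \<subseteq> H"
  shows "card (H // merges R [(a, b), (c, d), (e, f)]) + (if (a, b) \<in> R then 0 else 1) +
    (if (c, d) \<in> merge R a b then 0 else 1) +
    (if (e, f) \<in> merge (merge R a b) c d then 0 else 1) = card (H // R)"
  using card_two_merges[OF R, of H a b c d]
    card_merge[OF equiv_merge[OF equiv_merge[OF R]], of H e f a b c d] assms
  by simp

text \<open>A balanced partition of four cyclically ordered points contains one of the two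
  planar matchings.  Closing up with the matching contained in the partition gives the
  maximal number of circles; if the other matching is not contained in it too, it gives one circle
  less.\<close>

lemma four_balanced_points:
  assumes R: "equiv UNIV R" and "finite H" "{c0, c1, c2, c3} \<subseteq> H"
    and balanced: "\<And>x. (\<Sum>i<4. if (x, [c0, c1, c2, c3] ! i) \<in> R then (-1) ^ i else 0 :: int) = 0"
  shows "card (H // merges R [(c0, c1), (c2, c3)]) \<le> card (H // merges R [(c0, c3), (c1, c2)]) + 1"
    and "(c0, c3) \<notin> R \<or> (c1, c2) \<notin> R \<Longrightarrow>
      card (H // merges R [(c0, c1), (c2, c3)]) = card (H // merges R [(c0, c3), (c1, c2)]) + 1"
proof -
  \<comment> \<open>relatedness becomes equality of the opaque values \<open>k x\<close>, on which the case analyses work\<close>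
  define k where "k x = R `` {x}" for x
  have k: "(x, y) \<in> R \<longleftrightarrow> k x = k y" for x y
    using R unfolding k_def by (simp add: equiv_class_eq_iff)
  have sum4: "(\<Sum>i<4. f i) = f 0 + f 1 + f 2 + f 3" for f :: "nat \<Rightarrow> int"
    by (simp add: eval_nat_numeral)
  have b: "(if k x = k c0 then 1 else 0) - (if k x = k c1 then 1 else 0) +
      (if k x = k c2 then 1 else 0) - (if k x = k c3 then 1 else 0) = (0 :: int)" for x
    using balanced[of x] unfolding sum4 k by (simp split: if_splits)
  have cases: "k c0 = k c1 \<and> k c2 = k c3 \<or> k c0 = k c3 \<and> k c1 = k c2"
    using b[of c0] b[of c2] by (auto split: if_splits)
  note n = card_two_merges[OF R \<open>finite H\<close>, of c0 c3 c1 c2, unfolded mem_merge k]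
    card_two_merges[OF R \<open>finite H\<close>, of c0 c1 c2 c3, unfolded mem_merge k]
  show "card (H // merges R [(c0, c1), (c2, c3)]) \<le> card (H // merges R [(c0, c3), (c1, c2)]) + 1"
    using n assms(3) cases by (auto simp del: merges.simps split: if_splits)
  show "card (H // merges R [(c0, c1), (c2, c3)]) = card (H // merges R [(c0, c3), (c1, c2)]) + 1"
    if "(c0, c3) \<notin> R \<or> (c1, c2) \<notin> R"
    using n assms(3) that[unfolded k] cases by (auto simp del: merges.simps split: if_splits)
qed

text \<open>A balanced partition of six points contains one of the six matchings of even with odd points.
  Each joining of different classes costs one circle.  The comparison favours the matching
  \<open>12, 34, 50\<close> only if it is contained in the partition: when the first matching \<open>01, 23, 45\<close> is
  contained, nothing is gained, and in the other cases the two numbers agree unless coincidences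
  between the classes make one of these two matchings a part of the partition.\<close>

lemma six_balanced_points:
  assumes R: "equiv UNIV R" and "finite H" "{c0, c1, c2, c3, c4, c5} \<subseteq> H"
    and balanced: "\<And>x. (\<Sum>i<6. if (x, [c0, c1, c2, c3, c4, c5] ! i) \<in> R then (-1) ^ i else 0 :: int) = 0"
    and more: "card (H // merges R [(c0, c1), (c2, c3), (c4, c5)]) <
      card (H // merges R [(c1, c2), (c3, c4), (c5, c0)])"
  shows "(c1, c2) \<in> R \<and> (c3, c4) \<in> R \<and> (c5, c0) \<in> R"
proof -
  define k where "k x = R `` {x}" for x
  have k: "(x, y) \<in> R \<longleftrightarrow> k x = k y" for x y
    using R unfolding k_def by (simp add: equiv_class_eq_iff)
  have sum6: "(\<Sum>i<6. f i) = f 0 + f 1 + f 2 + f 3 + f 4 + f 5" for f :: "nat \<Rightarrow> int"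
    by (simp add: eval_nat_numeral)
  have b: "(if k x = k c0 then 1 else 0) - (if k x = k c1 then 1 else 0) +
      (if k x = k c2 then 1 else 0) - (if k x = k c3 then 1 else 0) +
      (if k x = k c4 then 1 else 0) - (if k x = k c5 then 1 else 0) = (0 :: int)" for x
    using balanced[of x] unfolding sum6 k by (simp split: if_splits)
  have "k c0 = k c1 \<or> k c0 = k c3 \<or> k c0 = k c5"
    using b[of c0] by (auto split: if_splits)
  then consider "k c0 = k c1" "k c2 = k c3" "k c4 = k c5" | "k c0 = k c1" "k c2 = k c5" "k c4 = k c3"
    | "k c0 = k c3" "k c2 = k c1" "k c4 = k c5" | "k c0 = k c3" "k c2 = k c5" "k c4 = k c1"
    | "k c0 = k c5" "k c2 = k c1" "k c4 = k c3" | "k c0 = k c5" "k c2 = k c3" "k c4 = k c1"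
    using b[of c2] b[of c4] by (elim disjE) (auto split: if_splits)
  then show ?thesis
    using card_three_merges[OF R \<open>finite H\<close>, of c0 c1 c2 c3 c4 c5]
      card_three_merges[OF R \<open>finite H\<close>, of c1 c2 c3 c4 c5 c0] more assms(3)
    unfolding mem_merge k
    by cases (auto simp del: merges.simps split: if_splits)
qed

section \<open>Diagrams that agree outside a disk\<close>

lemma agree_outside_sym: "agree_outside D I D' I' \<Longrightarrow> agree_outside D' I' D I"
  by (auto simp: agree_outside_def)

lemma crossing_darts_agree:
  assumes "disk_in_diagram D I bs" "agree_outside D I D' I'" "d \<in> crossing_darts D - I"
  shows "d \<in> crossing_darts D' - I'"
proof -
  interpret disk_in_diagram D I bs by fact
  have "orbit (rot D) d = orbit (rot D') d"
  proof (rule orbit_cong0[OF assms(3)])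
    show "rot D \<in> crossing_darts D - I \<rightarrow> crossing_darts D - I"
      using crossing_rot_inside by auto
  qed (use assms(2) in \<open>auto simp: agree_outside_def crossing_darts_def\<close>)
  moreover have "d \<in> darts D' - I'"
    using assms(2,3) by (auto simp: agree_outside_def crossing_darts_def)
  ultimately show ?thesis using assms(3) by (simp add: crossing_darts_def)
qed

locale local_replacement =
  disk_in_diagram D I bs + new: disk_in_diagram D' I' bs
  for D I D' I' and bs :: "'d list" +
  assumes agree: "agree_outside D I D' I'"
begin

lemma outside_eq: "darts D' - I' = outside"
  using agree by (simp add: agree_outside_def)

lemma rot_eq: "d \<in> outside \<Longrightarrow> rot D' d = rot D d"
  and edge_eq: "d \<in> outside \<Longrightarrow> edge D' d = edge D d"
  using agree unfolding agree_outside_def by metis+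

lemma rot_boundary_eq: "p \<in> set bs \<Longrightarrow> rot D' p = rot D p"
  using rot_eq[OF rot_boundary] rot_rot_boundary new.rot_rot_boundary new.rot_inj by metis

lemma crossing_darts_eq: "crossing_darts D' - I' = crossing_darts D - I"
  using crossing_darts_agree[OF disk_in_diagram_axioms agree]
    crossing_darts_agree[OF new.disk_in_diagram_axioms agree_outside_sym[OF agree]] by blast

lemma resolve_eq: "d \<in> outside \<Longrightarrow> resolve D' X d = resolve D X d"
proof -
  assume d: "d \<in> outside"
  then have d': "d \<in> darts D' - I'" by (simp add: outside_eq)
  have cr: "d \<in> crossing_darts D' \<longleftrightarrow> d \<in> crossing_darts D"
    using crossing_darts_eq d d' by blast
  have ov: "d \<in> over D' \<longleftrightarrow> d \<in> over D"
    using agree d d' unfolding agree_outside_def by blast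
  have "inv (rot D') d = inv (rot D) d" if "d \<in> crossing_darts D"
  proof -
    have "inv (rot D) d \<in> outside"
      using that d crossing_inv_rot_inside inv_rot_in by auto
    then have "rot D' (inv (rot D) d) = d" using rot_eq by simp
    then show ?thesis by (metis new.inv_rot(1))
  qed
  then show "resolve D' X d = resolve D X d"
    using rot_eq[OF d] by (simp add: resolve_def cr ov)
qed

lemma curves_eq: "curves D' (resolve D' X) (darts D' - I') = curves D (resolve D X) outside"
  unfolding curves_def outside_eq
  by (rule arg_cong[where f = rtrancl]) (auto simp: edge_eq resolve_eq)

text \<open>The number of state circles meeting the exterior, if the inner matching is \<open>ps\<close>.  This refers to \<open>D\<close>
  only, but the exterior curves and the exterior ends of the boundary points are shared by \<open>D'\<close>.\<close>

definition circles_through :: "resolution \<Rightarrow> ('d \<times> 'd) list \<Rightarrow> nat" where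
  "circles_through X ps = card (outside // merges (curves D (resolve D X) outside)
    (map (map_prod (rot D) (rot D)) ps))"

lemma circles_old: "inside_state X ps k \<Longrightarrow> state_circles D X = circles_through X ps + k"
  by (simp add: circles_through_def state_circles_inside)

lemma circles_new:
  assumes "new.inside_state X ps k"
  shows "state_circles D' X = circles_through X ps + k"
proof -
  have "set ps \<subseteq> set bs \<times> set bs" using assms by (simp add: new.inside_state_def)
  then have "map (map_prod (rot D') (rot D')) ps = map (map_prod (rot D) (rot D)) ps"
    using rot_boundary_eq by auto
  then show ?thesis
    using new.state_circles_inside[OF assms, unfolded curves_eq, unfolded outside_eq]
    unfolding circles_through_def by (simp only:)
qed

lemma four_boundary_points:
  assumes bs: "bs = [p0, p1, p2, p3]"
  shows "circles_through X [(p0, p1), (p2, p3)] \<le> circles_through X [(p0, p3), (p1, p2)] + 1"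
    and "\<not> (joins_outside D (resolve D X) I p0 p3 \<and> joins_outside D (resolve D X) I p1 p2) \<Longrightarrow>
      circles_through X [(p0, p1), (p2, p3)] = circles_through X [(p0, p3), (p1, p2)] + 1"
proof -
  let ?R = "curves D (resolve D X) outside"
  have R: "equiv UNIV ?R" and fin: "finite outside" using equiv_curves finite_darts by auto
  have sub: "{rot D p0, rot D p1, rot D p2, rot D p3} \<subseteq> outside"
    using rot_boundary bs by auto
  have bal: "(\<Sum>i<4. if (x, [rot D p0, rot D p1, rot D p2, rot D p3] ! i) \<in> ?R
      then (-1) ^ i else 0 :: int) = 0" for x
  proof -
    have "length bs = 4" "map (rot D) bs = [rot D p0, rot D p1, rot D p2, rot D p3]" by (simp_all add: bs)
    then show ?thesis using balanced_points[of x X] by (simp only:) simp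
  qed
  note four = four_balanced_points[OF R fin sub bal]
  show "circles_through X [(p0, p1), (p2, p3)] \<le> circles_through X [(p0, p3), (p1, p2)] + 1"
    using four(1) by (simp add: circles_through_def del: merges.simps)
  show "circles_through X [(p0, p1), (p2, p3)] = circles_through X [(p0, p3), (p1, p2)] + 1"
    if "\<not> (joins_outside D (resolve D X) I p0 p3 \<and> joins_outside D (resolve D X) I p1 p2)"
    using four(2) that by (simp add: circles_through_def joins_outside_def del: merges.simps)
qed

lemma six_boundary_points:
  assumes bs: "bs = [p0, p1, p2, p3, p4, p5]"
    and more: "circles_through X [(p0, p1), (p2, p3), (p4, p5)] < circles_through X [(p1, p2), (p3, p4), (p5, p0)]"
  shows "joins_outside D (resolve D X) I p1 p2 \<and> joins_outside D (resolve D X) I p3 p4 \<and>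
    joins_outside D (resolve D X) I p5 p0"
proof -
  let ?R = "curves D (resolve D X) outside"
  have R: "equiv UNIV ?R" and fin: "finite outside" using equiv_curves finite_darts by auto
  have sub: "{rot D p0, rot D p1, rot D p2, rot D p3, rot D p4, rot D p5} \<subseteq> outside"
    using rot_boundary bs by auto
  have bal: "(\<Sum>i<6. if (x, [rot D p0, rot D p1, rot D p2, rot D p3, rot D p4, rot D p5] ! i) \<in> ?R
      then (-1) ^ i else 0 :: int) = 0" for x
  proof -
    have "length bs = 6" "map (rot D) bs = [rot D p0, rot D p1, rot D p2, rot D p3, rot D p4, rot D p5]"
      by (simp_all add: bs)
    then show ?thesis using balanced_points[of x X] by (simp only:) simp
  qed
  show ?thesis
    using six_balanced_points[OF R fin sub bal] more
    by (simp add: circles_through_def joins_outside_def del: merges.simps)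
qed

text \<open>For one resolution type \<open>X\<close> two crossings are separated at the boundary and the move changes the
  matching; for the other type only one is, and the matching is preserved.\<close>

lemma triangle_states:
  assumes tri: "triangle_tangle D I bs h0 h1 h2" "triangle_tangle D' I' (rotate1 bs) h1 h2 h0"
  obtains X p0 p1 p2 p3 p4 p5 where "bs = [p0, p1, p2, p3, p4, p5]"
    "inside_state X [(p0, p1), (p2, p3), (p4, p5)] 0" "new.inside_state X [(p1, p2), (p3, p4), (p5, p0)] 0"
    "\<And>Y. Y \<noteq> X \<Longrightarrow> \<exists>ps. inside_state Y ps 0 \<and> new.inside_state Y ps 0"
    "crossing_number D' = crossing_number D"
proof -
  obtain p0 p1 p2 p3 p4 p5 where bs: "bs = [p0, p1, p2, p3, p4, p5]"
    and old: "\<And>X. inside_state X (triangle_matching p0 p1 p2 p3 p4 p5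
       ((h0 > h1) = (X = Res_B)) ((h1 > h2) = (X = Res_B)) ((h2 > h0) = (X = Res_B))) 0"
    and c: "4 * crossing_number D = card (crossing_darts D - I) + 12"
    using triangle_state[OF tri(1)] by metis
  obtain q0 q1 q2 q3 q4 q5 where q: "rotate1 bs = [q0, q1, q2, q3, q4, q5]"
    and new': "\<And>X. new.inside_state X (triangle_matching q0 q1 q2 q3 q4 q5
       ((h1 > h2) = (X = Res_B)) ((h2 > h0) = (X = Res_B)) ((h0 > h1) = (X = Res_B))) 0"
    and c': "4 * crossing_number D' = card (crossing_darts D' - I') + 12"
    using new.triangle_state[OF tri(2)] by (metis length_rotate1 set_rotate1)
  have new: "new.inside_state X (triangle_matching p1 p2 p3 p4 p5 p0
       ((h1 > h2) = (X = Res_B)) ((h2 > h0) = (X = Res_B)) ((h0 > h1) = (X = Res_B))) 0" for X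
    using new'[of X] q bs by simp
  have h: "distinct [h0, h1, h2]" using tri by (simp add: triangle_tangle_def)
  let ?u = "\<lambda>X. (h0 > h1) = (X = Res_B)" and ?v = "\<lambda>X. (h1 > h2) = (X = Res_B)"
    and ?w = "\<lambda>X. (h2 > h0) = (X = Res_B)"
  \<comment> \<open>at least two crossings are separated; the flags are negated when the resolution type changes\<close>
  define two where "two X \<longleftrightarrow> ?u X \<and> ?v X \<or> ?v X \<and> ?w X \<or> ?w X \<and> ?u X" for X
  have two_A: "two Res_A \<longleftrightarrow> \<not> two Res_B" and some: "?u X \<or> ?v X \<or> ?w X" for X
    using h by (auto simp: two_def)
  define X where "X = (if two Res_A then Res_A else Res_B)"
  have X: "two X" using two_A by (simp add: X_def)
  have other: "\<not> two Y" if "Y \<noteq> X" for Y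
    using that two_A by (cases Y) (auto simp: X_def split: if_splits)
  have same: "\<exists>ps. inside_state Y ps 0 \<and> new.inside_state Y ps 0" if "Y \<noteq> X" for Y
  proof -
    have n: "\<not> (?u Y \<and> ?v Y \<or> ?v Y \<and> ?w Y \<or> ?w Y \<and> ?u Y)" using other[OF that] unfolding two_def .
    have "new.inside_state Y (triangle_matching p0 p1 p2 p3 p4 p5 (?u Y) (?v Y) (?w Y)) 0"
      by (rule new.inside_state_cong[OF new[of Y]], rule triangle_matching_rotate[OF n some])
    then show ?thesis using old by blast
  qed
  have "inside_state X [(p0, p1), (p2, p3), (p4, p5)] 0"
    using old[of X] unfolding triangle_matching_two[OF X[unfolded two_def]] .
  moreover have "new.inside_state X [(p1, p2), (p3, p4), (p5, p0)] 0"
  proof -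
    have "?v X \<and> ?w X \<or> ?w X \<and> ?u X \<or> ?u X \<and> ?v X" using X unfolding two_def by blast
    from triangle_matching_two[OF this] show ?thesis using new[of X] by metis
  qed
  moreover have "crossing_number D' = crossing_number D" using c c' crossing_darts_eq by simp
  ultimately show thesis using that[OF bs _ _ same] by blast
qed

end

section \<open>Reidemeister moves that lower the Turaev genus\<close>

theorem theorem1p3:
  fixes D D' :: "'d diagram" and I I' :: "'d set" and bs :: "'d list" and m :: move_type
  assumes move: "reidemeister_move m D I D' I' bs"
    and genus: "turaev_genus D' < turaev_genus D"
  shows "(m = R2_remove \<or> m = R3) \<and>
    (m = R2_remove \<longrightarrow>
      (\<forall>a b c d.
         distinct [a, b, c, d] \<and> set bs = {a, b, c, d} \<and>
         joins_inside D' (straight D') I' a c \<and> joins_inside D' (straight D') I' b d \<and>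
         (\<forall>X. joins_inside D (resolve D X) I a b \<and> joins_inside D (resolve D X) I c d)
         \<longrightarrow> (\<exists>X. joins_outside D (resolve D X) I a c \<and> joins_outside D (resolve D X) I b d))) \<and>
    (m = R3 \<longrightarrow>
      (\<forall>X a b c d e f.
         inside_matching D (resolve D X) I bs \<noteq> inside_matching D' (resolve D' X) I' bs \<and>
         in_cyclic_order bs [a, b, c, d, e, f] \<and>
         joins_inside D (resolve D X) I a b \<and> joins_inside D (resolve D X) I c d \<and>
         joins_inside D (resolve D X) I e f \<and>
         joins_inside D' (resolve D' X) I' a f \<and> joins_inside D' (resolve D' X) I' b c \<and>
         joins_inside D' (resolve D' X) I' d e
         \<longrightarrow> joins_outside D (resolve D X) I a f \<and> joins_outside D (resolve D X) I b c \<and>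
             joins_outside D (resolve D X) I d e))"
proof -
  interpret local_replacement D I D' I' bs
    using move by unfold_locales (auto simp: reidemeister_move_def)
  have local: "local_move m D I D' I' bs" using move by (simp add: reidemeister_move_def)
  have g: "crossing_number D' + state_circles D Res_A + state_circles D Res_B <
      crossing_number D + state_circles D' Res_A + state_circles D' Res_B"
    using genus unfolding turaev_genus_def by simp
  note o = crossing_darts_eq
  show ?thesis
  proof (cases m)
    case R1_create
    obtain p q where old: "bs = [p, q]" "\<And>X. inside_state X [(p, q)] 0"
        "4 * crossing_number D = card (crossing_darts D - I)"
      using arc_state local R1_create by auto
    obtain p' q' h where new': "bs = [p', q']"
        "\<And>X. new.inside_state X [(p', q')] (if h = (X = Res_B) then 1 else 0)"
        "4 * crossing_number D' = card (crossing_darts D' - I') + 4"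
      using new.kink_state local R1_create by (metis local_move.simps(1))
    have eq: "p' = p" "q' = q" using old new' by auto
    show ?thesis
      using g old(3) new'(3) o circles_old[OF old(2)] circles_new[OF new'(2)] by (cases h) (auto simp: eq)
  next
    case R1_remove
    obtain p q where new': "bs = [p, q]" "\<And>X. new.inside_state X [(p, q)] 0"
        "4 * crossing_number D' = card (crossing_darts D' - I')"
      using new.arc_state local R1_remove by auto
    obtain p' q' h where old: "bs = [p', q']"
        "\<And>X. inside_state X [(p', q')] (if h = (X = Res_B) then 1 else 0)"
        "4 * crossing_number D = card (crossing_darts D - I) + 4"
      using kink_state local R1_remove by (metis local_move.simps(2))
    have eq: "p' = p" "q' = q" using old new' by auto
    show ?thesis
      using g old(3) new'(3) o circles_old[OF old(2)] circles_new[OF new'(2)] by (cases h) (auto simp: eq)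
  next
    case R2_create
    obtain nw sw se ne where old: "bs = [nw, sw, se, ne]" "\<And>X. inside_state X [(nw, ne), (sw, se)] 0"
        "4 * crossing_number D = card (crossing_darts D - I)"
      using parallel_state local R2_create by (metis local_move.simps(3))
    obtain nw' sw' se' ne' where new': "bs = [nw', sw', se', ne']"
        "\<And>X. new.inside_state X [(nw', sw'), (se', ne')] 0"
        "4 * crossing_number D' = card (crossing_darts D' - I') + 8"
      using new.bigon_state local R2_create by (metis local_move.simps(3))
    have eq: "nw' = nw" "sw' = sw" "se' = se" "ne' = ne" using old new' by auto
    have "state_circles D' X \<le> state_circles D X + 1" for X
      using circles_old[OF old(2), of X] circles_new[OF new'(2), of X]
        four_boundary_points(1)[OF old(1), of X] by (simp add: eq)
    from this[of Res_A] this[of Res_B] show ?thesis using g old(3) new'(3) o by simp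
  next
    case R2_remove
    obtain nw sw se ne where old: "bs = [nw, sw, se, ne]" "\<And>X. inside_state X [(nw, sw), (se, ne)] 0"
        "4 * crossing_number D = card (crossing_darts D - I) + 8"
      using bigon_state local R2_remove by (metis local_move.simps(4))
    obtain nw' sw' se' ne' where new': "bs = [nw', sw', se', ne']"
        "\<And>X. new.inside_state X [(nw', ne'), (sw', se')] 0"
        "4 * crossing_number D' = card (crossing_darts D' - I')" "I' = set bs"
      using new.parallel_state local R2_remove by (metis local_move.simps(4))
    have eq: "nw' = nw" "sw' = sw" "se' = se" "ne' = ne" using old new' by auto
    \<comment> \<open>two crossings disappear; the genus drops unless both states lose a circle\<close>
    have "\<exists>X. joins_outside D (resolve D X) I nw ne \<and> joins_outside D (resolve D X) I sw se"
    proof (rule ccontr)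
      assume "\<not> ?thesis"
      then have "state_circles D X = state_circles D' X + 1" for X
        using circles_old[OF old(2), of X] circles_new[OF new'(2), of X]
          four_boundary_points(2)[OF old(1), of X] by (simp add: eq)
      from this[of Res_A] this[of Res_B] show False using g old(3) new'(3) o by simp
    qed
    then obtain X where X: "joins_outside D (resolve D X) I nw ne" "joins_outside D (resolve D X) I sw se"
      by blast
    have "joins_outside D (resolve D X) I x y"
      if "joins_inside D' (straight D') I' x y" "x \<noteq> y" "x \<in> set bs" "y \<in> set bs" for x y
    proof -
      \<comment> \<open>all vertices of the new tangle are marked points, where strands and states agree\<close>
      have "d \<in> I' \<Longrightarrow> straight D' d = resolve D' X d" for d
        using new.boundary_noncrossing new'(4) by (simp add: straight_def resolve_def)
      then have "curves D' (straight D') I' = curves D' (resolve D' X) I'"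
        unfolding curves_def by (intro arg_cong[where f = rtrancl]) auto
      then have "joins_inside D' (resolve D' X) I' x y" using that(1) by (simp add: joins_inside_def)
      then have "(x, y) \<in> {(nw, ne), (sw, se)} \<or> (y, x) \<in> {(nw, ne), (sw, se)}"
        using new.joins_inside_iff[OF new'(2) that(3,4)] that(2) by (simp add: eq)
      then show ?thesis using X joins_outside_sym by auto
    qed
    then show ?thesis using R2_remove by auto
  next
    case R3
    then obtain h0 h1 h2 where tri: "triangle_tangle D I bs h0 h1 h2"
        "triangle_tangle D' I' (rotate1 bs) h1 h2 h0"
      using local by auto
    obtain X p0 p1 p2 p3 p4 p5 where bs: "bs = [p0, p1, p2, p3, p4, p5]"
      and old: "inside_state X [(p0, p1), (p2, p3), (p4, p5)] 0"
      and new': "new.inside_state X [(p1, p2), (p3, p4), (p5, p0)] 0"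
      and same: "\<And>Y. Y \<noteq> X \<Longrightarrow> \<exists>ps. inside_state Y ps 0 \<and> new.inside_state Y ps 0"
      and c: "crossing_number D' = crossing_number D"
      using triangle_states[OF tri] by metis
    have "state_circles D Y = state_circles D' Y" if "Y \<noteq> X" for Y
      using same[OF that] circles_old circles_new by metis
    then have "state_circles D X < state_circles D' X"
      using g c by (cases X) fastforce+
    then have out: "joins_outside D (resolve D X) I p1 p2" "joins_outside D (resolve D X) I p3 p4"
        "joins_outside D (resolve D X) I p5 p0"
      using six_boundary_points[OF bs, of X] circles_old[OF old] circles_new[OF new'] by auto
    have join: "joins_outside D (resolve D X) I x y"
      if "joins_inside D' (resolve D' X) I' x y" "x \<noteq> y" "x \<in> set bs" "y \<in> set bs" for x y
      using new.joins_inside_iff[OF new' that(3,4)] that(1,2) out joins_outside_sym by auto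
    have X_eq: "Y = X"
      if "inside_matching D (resolve D Y) I bs \<noteq> inside_matching D' (resolve D' Y) I' bs" for Y
    proof (rule ccontr)
      assume "Y \<noteq> X"
      then obtain ps where "inside_state Y ps 0" "new.inside_state Y ps 0" using same by blast
      then show False using that inside_matching_eq[of Y ps 0] new.inside_matching_eq[of Y ps 0] by simp
    qed
    have cyc: "distinct ps \<and> set ps = set bs" if "in_cyclic_order bs ps" for ps
      using that distinct_boundary by (auto simp: in_cyclic_order_def)
    show ?thesis
    proof (intro conjI impI allI; (elim conjE)?)
      show "m = R2_remove \<or> m = R3" using R3 by simp
    next
      fix Y a b c d e f
      assume Y: "inside_matching D (resolve D Y) I bs \<noteq> inside_matching D' (resolve D' Y) I' bs"
        and ord: "in_cyclic_order bs [a, b, c, d, e, f]"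
        and j: "joins_inside D' (resolve D' Y) I' a f" "joins_inside D' (resolve D' Y) I' b c"
          "joins_inside D' (resolve D' Y) I' d e"
      have YX: "Y = X" using Y by (rule X_eq)
      have mem: "distinct [a, b, c, d, e, f]" "a \<in> set bs" "b \<in> set bs" "c \<in> set bs" "d \<in> set bs" "e \<in> set bs" "f \<in> set bs"
        using cyc[OF ord] by auto
      show "joins_outside D (resolve D Y) I a f" "joins_outside D (resolve D Y) I b c"
          "joins_outside D (resolve D Y) I d e"
        using join j mem unfolding YX by auto
    qed (use R3 in auto)
  qed
qed

end
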